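(* Let $k\ge3$ be an integer and let $G=L_k(C_4)$, where $C_4$ is the $4$-cycle. Then $r_+(G)\ge\frac{1}{22}|V(G)|$.
   Context: Write $[k] = \{1,\dots,k\}$. $C_4$ is the graph with vertex set $\{0,1,2,3\}$ and edge set $\{\{0,1\},\{1,2\},\{2,3\},\{3,0\}\}$. Given a graph $G$ and an integer $k\ge2$, $L_k(G)$ is the graph with vertex set $\{i_p : i\in[k],\ p\in V(G)\}$ in which $i_p,j_q$ are adjacent iff either $i=j$ and $\{p,q\}\in E(G)$, or $i\ne j$, $p\ne q$ and $\{p,q\}\notin E(G)$. For a finite simple undirected graph $G$, $\mathrm{FRAC}(G)=\{x\in[0,1]^{V(G)} : x_i+x_j\le 1 \text{ for all } \{i,j\}\in E(G)\}$ and $\mathrm{STAB}(G)=\mathrm{conv}(\mathrm{FRAC}(G)\cap\{0,1\}^{V(G)})$. For a convex set $P\subseteq[0,1]^n$, let $\mathrm{cone}(P)=\left\{\begin{bmatrix}\lambda\\ \lambda x\end{bmatrix} : \lambda\ge 0,\ x\in P\right\}\subseteq\mathbb{R}^{n+1}$, with the new coordinate indexed by $0$. Let $\widehat{\mathrm{LS}}_+(P)$ be the set of symmetric positive semidefinite real $(n+1)\times(n+1)$ matrices $Y$ (rows and columns indexed by $0,1,\dots,n$) such that $Ye_0=\mathrm{diag}(Y)$ (the vector of diagonal entries) and $Ye_i,\ Y(e_0-e_i)\in\mathrm{cone}(P)$ for all $i\in[n]$, where $e_i$ is the $i$-th unit vector. Let $\mathrm{LS}_+(P)=\left\{x\in\mathbb{R}^n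 : \exists\, Y\in\widehat{\mathrm{LS}}_+(P),\ Ye_0=\begin{bmatrix}1\\ x\end{bmatrix}\right\}$, $\mathrm{LS}_+^0(P)=P$ and $\mathrm{LS}_+^{p}(P)=\mathrm{LS}_+(\mathrm{LS}_+^{p-1}(P))$ for $p\ge1$. The $\mathrm{LS}_+$-rank $r_+(G)$ of a graph $G$ is the least integer $p\ge0$ with $\mathrm{LS}_+^p(\mathrm{FRAC}(G))=\mathrm{STAB}(G)$. *)

theory Defs
  imports "HOL-Analysis.Analysis" "HOL-Library.Function_Algebras"
begin

text \<open>
  Vectors are functions with the pointwise vector space structure, so that \<^term>\<open>(hull)\<close>
  and \<^term>\<open>convex\<close> apply to them directly.
\<close>

instantiation "fun" :: (type, real_vector) real_vector
begin

definition scaleR_fun :: "real \<Rightarrow> ('a \<Rightarrow> 'b) \<Rightarrow> 'a \<Rightarrow> 'b"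
  where "scaleR_fun c f = (\<lambda>x. c *\<^sub>R f x)"

instance
  by standard (simp_all add: scaleR_fun_def fun_eq_iff scaleR_add_right scaleR_add_left)

end

lemma scaleR_fun_apply [simp]: "(c *\<^sub>R f) x = c *\<^sub>R f x"
  by (simp add: scaleR_fun_def)


subsection \<open>Graphs\<close>

record 'a ugraph =
  verts :: "'a set"
  edges :: "'a set set"

definition simple_graph :: "'a ugraph \<Rightarrow> bool" where
  "simple_graph G \<longleftrightarrow> finite (verts G) \<and>
     (\<forall>e \<in> edges G. \<exists>u v. u \<in> verts G \<and> v \<in> verts G \<and> u \<noteq> v \<and> e = {u, v})"

definition C4 :: "nat ugraph" where
  "C4 = \<lparr>verts = {0, 1, 2, 3}, edges = {{0, 1}, {1, 2}, {2, 3}, {3, 0}}\<rparr>"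

text \<open>The pair \<^term>\<open>(i, p)\<close> stands for the vertex $i_p$.\<close>

definition layered_graph :: "nat \<Rightarrow> 'a ugraph \<Rightarrow> (nat \<times> 'a) ugraph" where
  "layered_graph k G =
     \<lparr>verts = {1..k} \<times> verts G,
      edges = {{(i, p), (j, q)} | i p j q.
                 i \<in> {1..k} \<and> j \<in> {1..k} \<and> p \<in> verts G \<and> q \<in> verts G \<and>
                 (i = j \<and> {p, q} \<in> edges G \<or> i \<noteq> j \<and> p \<noteq> q \<and> {p, q} \<notin> edges G)}\<rparr>"

lemma simple_graph_C4: "simple_graph C4"
proof -
  have "\<exists>u v. u \<in> verts C4 \<and> v \<in> verts C4 \<and> u \<noteq> v \<and> {a, b} = {u, v}"
    if "a \<in> {0, 1, 2, 3}" "b \<in> {0, 1, 2, 3}" "a \<noteq> b" for a b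
    using that by (intro exI[of _ a] exI[of _ b]) (simp add: C4_def)
  then show ?thesis
    by (simp add: simple_graph_def C4_def)
qed

lemma simple_graph_layered_graph:
  assumes "simple_graph G"
  shows "simple_graph (layered_graph k G)"
proof -
  have ne: "p \<noteq> q" if pq: "{p, q} \<in> edges G" for p q
  proof
    assume "p = q"
    then obtain u v where "u \<noteq> v" "{p} = {u, v}"
      using assms pq unfolding simple_graph_def by auto
    then show False by blast
  qed
  have "\<exists>u v. u \<in> verts (layered_graph k G) \<and> v \<in> verts (layered_graph k G) \<and> u \<noteq> v \<and> e = {u, v}"
    if e: "e \<in> edges (layered_graph k G)" for e
  proof -
    obtain i p j q where "e = {(i, p), (j, q)}" "i \<in> {1..k}" "j \<in> {1..k}" "p \<in> verts G" "q \<in> verts G"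
      "i = j \<and> {p, q} \<in> edges G \<or> i \<noteq> j \<and> p \<noteq> q \<and> {p, q} \<notin> edges G"
      using e unfolding layered_graph_def by auto
    then show ?thesis
      using ne by (intro exI[of _ "(i, p)"] exI[of _ "(j, q)"]) (auto simp: layered_graph_def)
  qed
  moreover have "finite (verts (layered_graph k G))"
    using assms by (simp add: simple_graph_def layered_graph_def)
  ultimately show ?thesis by (simp add: simple_graph_def)
qed


subsection \<open>Fractional and integral stable set polytopes\<close>

text \<open>
  The space $\mathbb{R}^V$ is represented by the functions vanishing outside \<^term>\<open>V\<close>, so that
  each point of $\mathbb{R}^V$ is represented by exactly one function.
\<close>

definition coord_space :: "'a set \<Rightarrow> ('a \<Rightarrow> real) set" where
  "coord_space V = {x. \<forall>i. i \<notin> V \<longrightarrow> x i = 0}"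

definition FRAC :: "'a ugraph \<Rightarrow> ('a \<Rightarrow> real) set" where
  "FRAC G = {x \<in> coord_space (verts G).
     (\<forall>i \<in> verts G. 0 \<le> x i \<and> x i \<le> 1) \<and> (\<forall>i j. {i, j} \<in> edges G \<longrightarrow> x i + x j \<le> 1)}"

definition STAB :: "'a ugraph \<Rightarrow> ('a \<Rightarrow> real) set" where
  "STAB G = convex hull (FRAC G \<inter> {x. \<forall>i \<in> verts G. x i \<in> {0, 1}})"


subsection \<open>The \<open>LS\<^sub>+\<close> operator\<close>

text \<open>
  The index set $\{0\} \cup V$ is represented by \<^term>\<open>insert None (Some ` V)\<close>:
  \<^term>\<open>None\<close> is the homogenizing coordinate $0$, and \<open>homog \<lambda> x\<close> is
  the column vector with entry \<open>\<lambda>\<close> in coordinate $0$ and \<open>x\<close> below it.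
\<close>

definition index0 :: "'a set \<Rightarrow> 'a option set" where
  "index0 V = insert None (Some ` V)"

definition homog :: "real \<Rightarrow> ('a \<Rightarrow> real) \<Rightarrow> 'a option \<Rightarrow> real" where
  "homog l x = case_option l x"

definition homog_cone :: "('a \<Rightarrow> real) set \<Rightarrow> ('a option \<Rightarrow> real) set" where
  "homog_cone P = {homog l (l *\<^sub>R x) | l x. 0 \<le> l \<and> x \<in> P}"

definition unit_vec :: "'i \<Rightarrow> 'i \<Rightarrow> real" where
  "unit_vec i = (\<lambda>j. if j = i then 1 else 0)"

definition mat_vec :: "'i set \<Rightarrow> ('i \<Rightarrow> 'i \<Rightarrow> real) \<Rightarrow> ('i \<Rightarrow> real) \<Rightarrow> 'i \<Rightarrow> real" where
  "mat_vec I Y z = (\<lambda>i. \<Sum>j\<in>I. Y i j * z j)"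

definition mat_diag :: "('i \<Rightarrow> 'i \<Rightarrow> real) \<Rightarrow> 'i \<Rightarrow> real" where
  "mat_diag Y = (\<lambda>i. Y i i)"

text \<open>Like vectors, matrices over \<^term>\<open>I\<close> vanish outside \<^term>\<open>I \<times> I\<close>.\<close>

definition psd_matrices :: "'i set \<Rightarrow> ('i \<Rightarrow> 'i \<Rightarrow> real) set" where
  "psd_matrices I = {Y.
     (\<forall>i j. \<not> (i \<in> I \<and> j \<in> I) \<longrightarrow> Y i j = 0) \<and>
     (\<forall>i j. Y i j = Y j i) \<and>
     (\<forall>z. 0 \<le> (\<Sum>i\<in>I. z i * mat_vec I Y z i))}"

definition LS_plus_matrices ::
  "'a set \<Rightarrow> ('a \<Rightarrow> real) set \<Rightarrow> ('a option \<Rightarrow> 'a option \<Rightarrow> real) set" where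
  "LS_plus_matrices V P = {Y \<in> psd_matrices (index0 V).
     mat_vec (index0 V) Y (unit_vec None) = mat_diag Y \<and>
     (\<forall>i \<in> V. mat_vec (index0 V) Y (unit_vec (Some i)) \<in> homog_cone P \<and>
              mat_vec (index0 V) Y (unit_vec None - unit_vec (Some i)) \<in> homog_cone P)}"

definition LS_plus :: "'a set \<Rightarrow> ('a \<Rightarrow> real) set \<Rightarrow> ('a \<Rightarrow> real) set" where
  "LS_plus V P =
     {x. \<exists>Y \<in> LS_plus_matrices V P. mat_vec (index0 V) Y (unit_vec None) = homog 1 x}"

text \<open>
  The minimum exists for every finite simple graph, since $n$ iterations of the operator reach the
  integer hull of a convex subset of $[0,1]^n$ (Lovasz and Schrijver).
\<close>

definition LS_plus_rank :: "'a ugraph \<Rightarrow> nat" where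
  "LS_plus_rank G = (LEAST p. (LS_plus (verts G) ^^ p) (FRAC G) = STAB G)"

end

theory Submission
  imports Defs
begin

text \<open>
  The bound is proved by exhibiting, for each \<open>p\<close> with \<open>11 p < 2 k\<close>, a
  point of the \<open>p\<close>-th iterate that violates a valid inequality of the stable set
  polytope. As $|V(G)| = 4k$, this excludes all ranks below $|V(G)| / 22$, once it is known that
  some iterate equals the stable set polytope (\<open>LS_plus_iterate_eq_STAB\<close>).

  The points are symmetric in the layers. On a set of \<open>n\<close> layers, $i_0$ and $i_2$
  have the value \<open>a\<close>, $i_1$ has the value \<open>b\<close> and $i_3$ has the value
  0; on some further layers $i_1$ has the value 1. So a relaxation is seen through a region in
  the plane of the pairs \<open>(a, b)\<close>. That region always contains \<open>(1/n, 1 -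
  1/n)\<close>, a mixture of stable sets, and the question is at which slope \<open>-m\<close>
  the region extends from this vertex to the right. The edge inequalities allow \<open>m =
  1\<close> (\<open>leaves_vertex_FRAC\<close>), while in the stable set polytope necessarily
  \<open>m \<ge> 2 (n - 1) / (n - 2)\<close> when \<open>n = k\<close>
  (\<open>layered_C4_valid_inequality\<close>).

  A layer leaves the picture when the operator conditions on one of its vertices. Conditioning
  on $i_1 = 1$ leaves a point of the same kind with \<open>n - 1\<close> layers. Conditioning on
  $i_0 = 1$ or on $i_1 = 0$ can be arranged to leave mixtures of stable sets, and conditioning
  on $i_0 = 0$ a mixture of a stable set and points with \<open>n - 1\<close> layers. By
  symmetry, positive semidefiniteness reduces to one \<open>2 \<times> 2\<close> determinant
  (\<open>quadratic_form_nonneg\<close>). Hence membership for \<open>n\<close> layers in the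
  next iterate follows from membership of two points for \<open>n - 1\<close> layers in the
  previous one (\<open>point_region_LS_plus\<close>).

  Close to the vertex this becomes a recursion for the slopes
  (\<open>leaves_vertex_step\<close>): if \<open>m'\<close> is possible for \<open>n - 1\<close>
  layers, then a slightly larger \<open>m\<close> is possible for \<open>n\<close> layers after
  one more application, with \<open>m - m'\<close> of order \<open>1 / n\<close>. Starting with
  \<open>s + 3\<close> layers, \<open>m = 1 + 7 p / (s + 3 p)\<close> is possible after
  \<open>p\<close> steps, and this stays below the slope of the stable set polytope as long as
  \<open>9 p \<le> 2 s + 5\<close> (\<open>schedule_inequalities\<close>). With \<open>k = s + 3
  + p\<close> the condition reads \<open>11 p < 2 k\<close>.
\<close>

section \<open>Cones, columns and convexity of the operator\<close>

lemma homog_simps [simp]: "homog l x None = l" "homog l x (Some i) = x i"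
  by (simp_all add: homog_def)

lemma scaleR_homog: "c *\<^sub>R homog l x = homog (c * l) (c *\<^sub>R x)"
  by (rule ext) (simp add: homog_def split: option.split)

lemma homog_cone_memI: "x \<in> P \<Longrightarrow> 0 \<le> l \<Longrightarrow> l *\<^sub>R homog 1 x \<in> homog_cone P"
  by (auto simp: homog_cone_def scaleR_homog)

lemma homog_cone_zero: "P \<noteq> {} \<Longrightarrow> 0 \<in> homog_cone P"
  using homog_cone_memI[of _ P 0] by auto

lemma homog_cone_scaleR:
  assumes "y \<in> homog_cone P" "0 \<le> t"
  shows "t *\<^sub>R y \<in> homog_cone P"
proof -
  obtain l x where "y = homog l (l *\<^sub>R x)" "0 \<le> l" "x \<in> P"
    using assms(1) by (auto simp: homog_cone_def)
  then have "t *\<^sub>R y = homog (t * l) ((t * l) *\<^sub>R x)" "0 \<le> t * l"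
    using assms(2) by (auto simp: scaleR_homog)
  then show ?thesis
    using \<open>x \<in> P\<close> by (auto simp: homog_cone_def)
qed

lemma homog_cone_add:
  assumes P: "convex P" and y: "y \<in> homog_cone P" and z: "z \<in> homog_cone P"
  shows "y + z \<in> homog_cone P"
proof -
  obtain l x where yl: "y = homog l (l *\<^sub>R x)" "0 \<le> l" "x \<in> P"
    using y by (auto simp: homog_cone_def)
  obtain l' x' where zl: "z = homog l' (l' *\<^sub>R x')" "0 \<le> l'" "x' \<in> P"
    using z by (auto simp: homog_cone_def)
  show ?thesis
  proof (cases "l + l' = 0")
    case True
    then have "l = 0" "l' = 0" using yl zl by auto
    then have "y + z = homog 0 (0 *\<^sub>R x)"
      using yl zl by (auto simp: fun_eq_iff homog_def split: option.split)
    then show ?thesis using yl(3) by (force simp: homog_cone_def)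
  next
    case False
    then have pos: "l + l' > 0" using yl zl by auto
    define w where "w = (l / (l + l')) *\<^sub>R x + (l' / (l + l')) *\<^sub>R x'"
    have "w \<in> P"
      unfolding w_def using P yl zl pos
      by (intro convexD) (auto simp: add_divide_distrib[symmetric])
    moreover have "(l + l') *\<^sub>R w = l *\<^sub>R x + l' *\<^sub>R x'"
      using pos by (simp add: w_def scaleR_add_right)
    then have "y + z = homog (l + l') ((l + l') *\<^sub>R w)"
      using yl zl by (simp add: fun_eq_iff homog_def split: option.split)
    ultimately show ?thesis
      using pos by (force simp: homog_cone_def)
  qed
qed

lemma convex_homog_cone: "convex P \<Longrightarrow> convex (homog_cone P)"
  by (rule convexI) (blast intro: homog_cone_add homog_cone_scaleR)

lemma mat_vec_unit_vec:
  assumes "finite I" "j \<in> I"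
  shows "mat_vec I Y (unit_vec j) = (\<lambda>i. Y i j)"
  using assms by (simp add: mat_vec_def unit_vec_def if_distrib cong: if_cong)

lemma mat_vec_diff: "mat_vec I Y (z - z') = mat_vec I Y z - mat_vec I Y z'"
  by (auto simp: mat_vec_def fun_eq_iff right_diff_distrib sum_subtractf)

lemma finite_index0 [simp]: "finite V \<Longrightarrow> finite (index0 V)"
  by (simp add: index0_def)

lemma None_in_index0 [simp]: "None \<in> index0 V"
  by (simp add: index0_def)

lemma Some_in_index0 [simp]: "Some i \<in> index0 V \<longleftrightarrow> i \<in> V"
  by (auto simp: index0_def)

text \<open>
  Multiplying by a unit vector selects a column, so membership in the polytope of the operator
  is a statement about the columns of \<open>Y\<close>; it is used in this form throughout.
\<close>

lemma LS_plus_iff: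
  assumes "finite V"
  shows "x \<in> LS_plus V P \<longleftrightarrow>
    (\<exists>Y. Y \<in> psd_matrices (index0 V) \<and> (\<lambda>u. Y u None) = homog 1 x \<and> (\<forall>u. Y u u = Y u None) \<and>
      (\<forall>i \<in> V. (\<lambda>u. Y u (Some i)) \<in> homog_cone P \<and>
               (\<lambda>u. Y u None - Y u (Some i)) \<in> homog_cone P))"
proof -
  have fi: "finite (index0 V)" using assms by simp
  have diff: "mat_vec (index0 V) Y (unit_vec None - unit_vec (Some i)) = (\<lambda>u. Y u None - Y u (Some i))"
    if "i \<in> V" for i Y
    using that fi by (simp add: mat_vec_diff mat_vec_unit_vec fun_eq_iff)
  have *: "(mat_vec (index0 V) Y (unit_vec None) = mat_diag Y) = (\<forall>u. Y u u = Y u None)" for Y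
    using fi by (auto simp: mat_vec_unit_vec mat_diag_def fun_eq_iff)
  show ?thesis
    unfolding LS_plus_def LS_plus_matrices_def mem_Collect_eq Bex_def *
    using fi by (simp add: mat_vec_unit_vec diff cong: ball_cong) blast
qed

lemma psd_matrices_convex: "convex (psd_matrices I)"
proof (rule convexI)
  fix Y Z :: "'a \<Rightarrow> 'a \<Rightarrow> real" and s t :: real
  assume Y: "Y \<in> psd_matrices I" and Z: "Z \<in> psd_matrices I" and st: "0 \<le> s" "0 \<le> t"
  have "(\<Sum>i\<in>I. z i * mat_vec I (s *\<^sub>R Y + t *\<^sub>R Z) z i) =
     s * (\<Sum>i\<in>I. z i * mat_vec I Y z i) + t * (\<Sum>i\<in>I. z i * mat_vec I Z z i)" for z
    by (simp add: mat_vec_def sum_distrib_left sum.distrib algebra_simps)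
  then show "s *\<^sub>R Y + t *\<^sub>R Z \<in> psd_matrices I"
    using Y Z st by (auto simp: psd_matrices_def)
qed

lemma convex_LS_plus:
  assumes V: "finite V" and P: "convex P"
  shows "convex (LS_plus V P)"
proof (rule convexI)
  fix x y :: "'a \<Rightarrow> real" and s t :: real
  assume x: "x \<in> LS_plus V P" and y: "y \<in> LS_plus V P" and st: "0 \<le> s" "0 \<le> t" "s + t = 1"
  obtain Y where Y: "Y \<in> psd_matrices (index0 V)" "(\<lambda>u. Y u None) = homog 1 x"
      "\<forall>u. Y u u = Y u None"
      "\<And>i. i \<in> V \<Longrightarrow> (\<lambda>u. Y u (Some i)) \<in> homog_cone P"
      "\<And>i. i \<in> V \<Longrightarrow> (\<lambda>u. Y u None - Y u (Some i)) \<in> homog_cone P"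
    using x unfolding LS_plus_iff[OF V] by blast
  obtain Z where Z: "Z \<in> psd_matrices (index0 V)" "(\<lambda>u. Z u None) = homog 1 y"
      "\<forall>u. Z u u = Z u None"
      "\<And>i. i \<in> V \<Longrightarrow> (\<lambda>u. Z u (Some i)) \<in> homog_cone P"
      "\<And>i. i \<in> V \<Longrightarrow> (\<lambda>u. Z u None - Z u (Some i)) \<in> homog_cone P"
    using y unfolding LS_plus_iff[OF V] by blast
  define W where "W = s *\<^sub>R Y + t *\<^sub>R Z"
  have W: "W u v = s * Y u v + t * Z u v" for u v by (simp add: W_def)
  have "W \<in> psd_matrices (index0 V)"
    unfolding W_def using Y Z st by (intro convexD[OF psd_matrices_convex]) auto
  moreover have "(\<lambda>u. W u None) = homog 1 (s *\<^sub>R x + t *\<^sub>R y)"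
    using Y(2) Z(2) st by (auto simp: W fun_eq_iff homog_def split: option.split)
  moreover have "\<forall>u. W u u = W u None" using Y(3) Z(3) by (simp add: W)
  moreover have "(\<lambda>u. W u (Some i)) \<in> homog_cone P" if "i \<in> V" for i
    using convexD[OF convex_homog_cone[OF P] Y(4)[OF that] Z(4)[OF that] st]
    by (simp add: W plus_fun_def scaleR_fun_def)
  moreover have "(\<lambda>u. W u None - W u (Some i)) \<in> homog_cone P" if "i \<in> V" for i
    using convexD[OF convex_homog_cone[OF P] Y(5)[OF that] Z(5)[OF that] st]
    by (simp add: W plus_fun_def scaleR_fun_def algebra_simps)
  ultimately show "s *\<^sub>R x + t *\<^sub>R y \<in> LS_plus V P"
    unfolding LS_plus_iff[OF V] by blast
qed

section \<open>The iterates reach the stable set polytope\<close>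

lemma integral_point_in_LS_plus:
  assumes V: "finite V" and x: "x \<in> P" "x \<in> coord_space V" "\<forall>i \<in> V. x i \<in> {0, 1}"
  shows "x \<in> LS_plus V P"
proof -
  define h where "h = homog 1 x"
  define Y where "Y = (\<lambda>u v. h u * h v)"
  have hV: "h u = 0" if "u \<notin> index0 V" for u
    using that x(2) by (cases u) (auto simp: h_def coord_space_def)
  have h01: "h u = 0 \<or> h u = 1" for u
    using x(2,3) by (cases u) (auto simp: h_def coord_space_def)
  have "0 \<le> (\<Sum>i\<in>index0 V. z i * mat_vec (index0 V) Y z i)" for z
  proof -
    have "(\<Sum>i\<in>index0 V. z i * mat_vec (index0 V) Y z i) = (\<Sum>i\<in>index0 V. z i * h i)\<^sup>2"
      by (simp add: mat_vec_def Y_def power2_eq_square sum_product sum_distrib_left algebra_simps)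
    then show ?thesis by simp
  qed
  then have "Y \<in> psd_matrices (index0 V)"
    using hV by (auto simp: psd_matrices_def Y_def)
  moreover have "(\<lambda>u. Y u None) = homog 1 x" by (simp add: Y_def h_def)
  moreover have "\<forall>u. Y u u = Y u None" using h01 by (auto simp: Y_def) (auto simp: h_def)
  moreover have "(\<lambda>u. Y u (Some i)) \<in> homog_cone P" if "i \<in> V" for i
    using homog_cone_memI[OF x(1), of "h (Some i)"] h01[of "Some i"]
    by (auto simp: Y_def scaleR_fun_def h_def mult.commute)
  moreover have "(\<lambda>u. Y u None - Y u (Some i)) \<in> homog_cone P" if "i \<in> V" for i
    using homog_cone_memI[OF x(1), of "1 - h (Some i)"] h01[of "Some i"]
    by (auto simp: Y_def scaleR_fun_def h_def algebra_simps)
  ultimately show ?thesis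
    unfolding LS_plus_iff[OF V] by blast
qed

text \<open>
  The column of \<open>i\<close> and its complement sum to the column of the homogenizing
  coordinate, and since the diagonal equals that column, the two summands have their
  \<open>i\<close>-th coordinate at its largest and smallest possible value. Convergence to the
  integer hull rests on this splitting.
\<close>

lemma LS_plus_split:
  assumes V: "finite V" and i: "i \<in> V" and x: "x \<in> LS_plus V P"
    and box: "P \<subseteq> {x \<in> coord_space V. \<forall>j. 0 \<le> x j \<and> x j \<le> 1}"
  obtains y z where "y \<in> P" "z \<in> P" "0 \<le> x i" "x i \<le> 1" "x = x i *\<^sub>R y + (1 - x i) *\<^sub>R z"
    "x i \<noteq> 0 \<Longrightarrow> y i = 1" "x i \<noteq> 1 \<Longrightarrow> z i = 0"
proof -
  obtain Y where Y: "Y \<in> psd_matrices (index0 V)" "(\<lambda>u. Y u None) = homog 1 x"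
      "\<forall>u. Y u u = Y u None" "(\<lambda>u. Y u (Some i)) \<in> homog_cone P"
      "(\<lambda>u. Y u None - Y u (Some i)) \<in> homog_cone P"
    using x i unfolding LS_plus_iff[OF V] by blast
  obtain l y where y: "(\<lambda>u. Y u (Some i)) = homog l (l *\<^sub>R y)" "0 \<le> l" "y \<in> P"
    using Y(4) by (auto simp: homog_cone_def)
  obtain l' z where z: "(\<lambda>u. Y u None - Y u (Some i)) = homog l' (l' *\<^sub>R z)" "0 \<le> l'" "z \<in> P"
    using Y(5) by (auto simp: homog_cone_def)
  have sym: "Y u v = Y v u" for u v using Y(1) by (auto simp: psd_matrices_def)
  have col0: "Y None None = 1" "Y (Some j) None = x j" for j
    using fun_cong[OF Y(2), of None] fun_cong[OF Y(2), of "Some j"] by auto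
  have "Y None (Some i) = l" using fun_cong[OF y(1), of None] by simp
  then have l: "l = x i" using sym[of None "Some i"] col0 by simp
  have l': "l' = 1 - x i" using fun_cong[OF z(1), of None] col0 \<open>Y None (Some i) = l\<close> l by simp
  have yj: "Y (Some j) (Some i) = x i * y j" for j
    using fun_cong[OF y(1), of "Some j"] l by simp
  have zj: "x j - Y (Some j) (Some i) = (1 - x i) * z j" for j
    using fun_cong[OF z(1), of "Some j"] l' col0 by simp
  have "x = x i *\<^sub>R y + (1 - x i) *\<^sub>R z"
  proof (rule ext)
    fix j show "x j = (x i *\<^sub>R y + (1 - x i) *\<^sub>R z) j"
      using yj[of j] zj[of j] by (simp add: algebra_simps)
  qed
  moreover have d: "Y (Some i) (Some i) = x i" by (metis Y(3) col0(2))
  have "x i \<noteq> 0 \<Longrightarrow> y i = 1" using yj[of i] d by simp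
  moreover have "x i \<noteq> 1 \<Longrightarrow> z i = 0" using zj[of i] d by simp
  ultimately show thesis using that y z l l' by auto
qed

lemma LS_plus_box:
  assumes V: "finite V"
    and box: "P \<subseteq> {x \<in> coord_space V. \<forall>j. 0 \<le> x j \<and> x j \<le> 1}"
  shows "LS_plus V P \<subseteq> {x \<in> coord_space V. \<forall>j. 0 \<le> x j \<and> x j \<le> 1}"
proof
  fix x assume x: "x \<in> LS_plus V P"
  have out: "x j = 0" if j: "j \<notin> V" for j
  proof -
    obtain Y where "Y \<in> psd_matrices (index0 V)" "(\<lambda>u. Y u None) = homog 1 x"
      using x unfolding LS_plus_iff[OF V] by blast
    then show ?thesis
      using j fun_cong[of "\<lambda>u. Y u None" "homog 1 x" "Some j"] by (auto simp: psd_matrices_def)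
  qed
  moreover have "0 \<le> x j \<and> x j \<le> 1" for j
  proof (cases "j \<in> V")
    case True
    show ?thesis by (rule LS_plus_split[OF V True x box]) auto
  qed (simp add: out)
  ultimately show "x \<in> {x \<in> coord_space V. \<forall>j. 0 \<le> x j \<and> x j \<le> 1}"
    by (auto simp: coord_space_def)
qed

text \<open>
  Each application makes one more coordinate integral. The induction peels off the innermost
  application: a point of \<open>LS_plus V P\<close> whose coordinates in \<open>T\<close> are
  integral splits along \<open>i\<close> into two points of \<open>P\<close>, and these keep the
  integral coordinates because 0 and 1 are extreme in \<open>[0,1]\<close>.
\<close>

lemma LS_plus_iterate_subset_hull:
  assumes V: "finite V" and T: "finite T" "T \<subseteq> V"
    and box: "P \<subseteq> {x \<in> coord_space V. \<forall>j. 0 \<le> x j \<and> x j \<le> 1}"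
  shows "(LS_plus V ^^ card T) P \<subseteq> convex hull (P \<inter> {x. \<forall>j \<in> T. x j \<in> {0, 1}})"
  using T box
proof (induction T arbitrary: P rule: finite_induct)
  case empty
  then show ?case by (simp add: hull_subset)
next
  case (insert i T)
  have i: "i \<in> V" and T: "T \<subseteq> V" using insert.prems by auto
  note box = insert.prems(2)
  let ?I = "P \<inter> {x. \<forall>j \<in> insert i T. x j \<in> {0, 1}}"
  have sub: "LS_plus V P \<inter> {x. \<forall>j \<in> T. x j \<in> {0, 1}} \<subseteq> convex hull ?I"
  proof
    fix x assume "x \<in> LS_plus V P \<inter> {x. \<forall>j \<in> T. x j \<in> {0, 1}}"
    then have x: "x \<in> LS_plus V P" and xT: "\<And>j. j \<in> T \<Longrightarrow> x j \<in> {0, 1}" by auto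
    obtain y z where yz: "y \<in> P" "z \<in> P" "0 \<le> x i" "x i \<le> 1"
      "x = x i *\<^sub>R y + (1 - x i) *\<^sub>R z" "x i \<noteq> 0 \<Longrightarrow> y i = 1" "x i \<noteq> 1 \<Longrightarrow> z i = 0"
      by (rule LS_plus_split[OF V i x box]) blast
    have b: "0 \<le> y j" "y j \<le> 1" "0 \<le> z j" "z j \<le> 1" for j using yz(1,2) box by auto
    have xj: "x j = x i * y j + (1 - x i) * z j" for j
      using fun_cong[OF yz(5), of j] by simp
    have int: "y j \<in> {0, 1} \<and> z j \<in> {0, 1}" if j: "j \<in> T" and t: "0 < x i" "x i < 1" for j
    proof -
      consider "x j = 0" | "x j = 1" using xT[OF j] by auto
      then show ?thesis
      proof cases
        case 1
        then have "x i * y j + (1 - x i) * z j = 0" using xj[of j] by simp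
        moreover have "0 \<le> x i * y j" "0 \<le> (1 - x i) * z j" using b[of j] t by auto
        ultimately have "x i * y j = 0" "(1 - x i) * z j = 0" by linarith+
        then show ?thesis using t by auto
      next
        case 2
        then have "x i * (1 - y j) + (1 - x i) * (1 - z j) = 0"
          using xj[of j] by (simp add: algebra_simps)
        moreover have "0 \<le> x i * (1 - y j)" "0 \<le> (1 - x i) * (1 - z j)" using b[of j] t by auto
        ultimately have "x i * (1 - y j) = 0" "(1 - x i) * (1 - z j) = 0" by linarith+
        then show ?thesis using t by auto
      qed
    qed
    consider "x i = 0" | "x i = 1" | "0 < x i" "x i < 1" using yz(3,4) by linarith
    then show "x \<in> convex hull ?I"
    proof cases
      case 1
      then have "x = z" using yz(5) by simp
      then have "x \<in> ?I" using 1 yz(2) xT by auto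
      then show ?thesis by (rule hull_inc)
    next
      case 2
      then have "x = y" using yz(5) by simp
      then have "x \<in> ?I" using 2 yz(1) xT by auto
      then show ?thesis by (rule hull_inc)
    next
      case 3
      then have "y \<in> ?I" "z \<in> ?I" using yz int by auto
      then have "x i *\<^sub>R y + (1 - x i) *\<^sub>R z \<in> convex hull ?I"
        using yz(3,4) by (intro convexD[OF convex_convex_hull]) (auto intro: hull_inc)
      then show ?thesis using yz(5) by simp
    qed
  qed
  have "(LS_plus V ^^ card (insert i T)) P = (LS_plus V ^^ card T) (LS_plus V P)"
    using insert.hyps by (simp add: funpow_Suc_right del: funpow.simps)
  also have "\<dots> \<subseteq> convex hull (LS_plus V P \<inter> {x. \<forall>j \<in> T. x j \<in> {0, 1}})"
    by (rule insert.IH[OF T LS_plus_box[OF V box]])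
  also have "\<dots> \<subseteq> convex hull ?I"
    using sub by (rule hull_minimal) (rule convex_convex_hull)
  finally show ?case .
qed

lemma convex_FRAC: "convex (FRAC G)"
proof (rule convexI)
  fix x y :: "'a \<Rightarrow> real" and s t :: real
  assume x: "x \<in> FRAC G" and y: "y \<in> FRAC G" and st: "0 \<le> s" "0 \<le> t" "s + t = 1"
  have le: "s * p + t * q \<le> 1" if "p \<le> 1" "q \<le> 1" for p q
    by (rule convex_bound_le[OF that st])
  have "s * x i + t * y i + (s * x j + t * y j) \<le> 1" if "{i, j} \<in> edges G" for i j
    using le[of "x i + x j" "y i + y j"] x y that by (simp add: FRAC_def algebra_simps)
  then show "s *\<^sub>R x + t *\<^sub>R y \<in> FRAC G"
    using x y st le by (auto simp: FRAC_def coord_space_def)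
qed

lemma convex_LS_plus_iterate: "finite V \<Longrightarrow> convex P \<Longrightarrow> convex ((LS_plus V ^^ p) P)"
  by (induction p) (simp_all add: convex_LS_plus)

lemma integral_point_in_LS_plus_iterate:
  assumes "finite V" "x \<in> P" "x \<in> coord_space V" "\<forall>i \<in> V. x i \<in> {0, 1}"
  shows "x \<in> (LS_plus V ^^ p) P"
  using assms by (induction p) (simp_all add: integral_point_in_LS_plus)

proposition LS_plus_iterate_eq_STAB:
  assumes "finite (verts G)"
  shows "(LS_plus (verts G) ^^ card (verts G)) (FRAC G) = STAB G"
proof
  have "FRAC G \<subseteq> {x \<in> coord_space (verts G). \<forall>j. 0 \<le> x j \<and> x j \<le> 1}"
  proof
    fix x assume "x \<in> FRAC G"
    then show "x \<in> {x \<in> coord_space (verts G). \<forall>j. 0 \<le> x j \<and> x j \<le> 1}"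
      unfolding FRAC_def coord_space_def mem_Collect_eq by (metis order_refl zero_le_one)
  qed
  then show "(LS_plus (verts G) ^^ card (verts G)) (FRAC G) \<subseteq> STAB G"
    using LS_plus_iterate_subset_hull[OF assms assms] by (simp add: STAB_def)
  have "x \<in> (LS_plus (verts G) ^^ card (verts G)) (FRAC G)"
    if "x \<in> FRAC G" "\<forall>i \<in> verts G. x i \<in> {0, 1}" for x
    using that assms by (intro integral_point_in_LS_plus_iterate) (auto simp: FRAC_def)
  then show "STAB G \<subseteq> (LS_plus (verts G) ^^ card (verts G)) (FRAC G)"
    unfolding STAB_def
    by (intro hull_minimal convex_LS_plus_iterate[OF assms convex_FRAC]) blast
qed

text \<open>
  A least number exists only if some number works, so the rank can be reasoned about only once
  the iterates are known to reach \<^const>\<open>STAB\<close>.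
\<close>

corollary LS_plus_rank_iterate:
  assumes "finite (verts G)"
  shows "(LS_plus (verts G) ^^ LS_plus_rank G) (FRAC G) = STAB G"
  unfolding LS_plus_rank_def using LS_plus_iterate_eq_STAB[OF assms] by (rule LeastI)

section \<open>Layered points\<close>

text \<open>
  All points considered vanish at the vertices $i_3$; they live on the graph
  \<open>L\<^sub>k\<close> of the path $0,1,2$. The layers in \<open>S\<close> carry the same
  pair of values. The layers in \<open>T\<close> are those where the middle vertex $i_1$ has
  been fixed to 1: it excludes only $i_0$, $i_2$ and the vertices $j_3$, so the other layers do
  not notice it.
\<close>

definition layer_point :: "nat set \<Rightarrow> nat set \<Rightarrow> real \<Rightarrow> real \<Rightarrow> nat \<times> nat \<Rightarrow> real" where
  "layer_point S T a b = (\<lambda>(i, p).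
     if i \<in> S then if p = 1 then b else if p = 0 \<or> p = 2 then a else 0
     else if i \<in> T \<and> p = 1 then 1 else 0)"

definition layer_indicator :: "nat set \<Rightarrow> nat set \<Rightarrow> nat set \<Rightarrow> nat \<times> nat \<Rightarrow> real" where
  "layer_indicator A0 A1 A2 =
     (\<lambda>(i, p). of_bool (p = 0 \<and> i \<in> A0 \<or> p = 1 \<and> i \<in> A1 \<or> p = 2 \<and> i \<in> A2))"

text \<open>
  The sets \<open>S\<close> and \<open>T\<close> are quantified here, so that the region for
  \<open>n - 1\<close> layers applies to the points that arise when a layer leaves
  \<open>S\<close>, whether or not it joins \<open>T\<close>.
\<close>

definition point_region :: "nat \<Rightarrow> (nat \<times> nat \<Rightarrow> real) set \<Rightarrow> nat \<Rightarrow> (real \<times> real) set" where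
  "point_region k P n = {(a, b). \<forall>S T. S \<subseteq> {1..k} \<longrightarrow> T \<subseteq> {1..k} \<longrightarrow> S \<inter> T = {} \<longrightarrow> card S = n \<longrightarrow>
     layer_point S T a b \<in> P}"

lemma verts_layered_C4: "verts (layered_graph k C4) = {1..k} \<times> {0, 1, 2, 3}"
  by (simp add: layered_graph_def C4_def)

lemma edges_layered_C4:
  "{(i, p), (j, q)} \<in> edges (layered_graph k C4) \<longleftrightarrow>
     i \<in> {1..k} \<and> j \<in> {1..k} \<and> p \<in> {0, 1, 2, 3} \<and> q \<in> {0, 1, 2, 3} \<and>
     (if i = j then odd (p + q) else p \<noteq> q \<and> even (p + q))"
proof -
  have verts_C4: "verts C4 = {0, 1, 2, 3}" by (simp add: C4_def)
  have C4: "{p, q} \<in> edges C4 \<longleftrightarrow> odd (p + q)" if "p \<in> {0, 1, 2, 3}" "q \<in> {0, 1, 2, 3}" for p q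
    using that by (elim insertE emptyE; simp add: C4_def doubleton_eq_iff)
  let ?E = "\<lambda>i p j q. i \<in> {1..k} \<and> j \<in> {1..k} \<and> p \<in> verts C4 \<and> q \<in> verts C4 \<and>
    (i = j \<and> {p, q} \<in> edges C4 \<or> i \<noteq> j \<and> p \<noteq> q \<and> {p, q} \<notin> edges C4)"
  have sym: "?E i p j q \<longleftrightarrow> ?E j q i p" for i p j q
  proof -
    have "{p, q} \<in> edges C4 \<longleftrightarrow> {q, p} \<in> edges C4" by (simp add: insert_commute)
    then show ?thesis by blast
  qed
  have "{(i, p), (j, q)} \<in> edges (layered_graph k C4) \<longleftrightarrow> ?E i p j q"
    unfolding layered_graph_def ugraph.simps mem_Collect_eq doubleton_eq_iff Pair_inject
    using sym[of i j p q] by blast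
  also have "\<dots> \<longleftrightarrow> i \<in> {1..k} \<and> j \<in> {1..k} \<and> p \<in> {0, 1, 2, 3} \<and> q \<in> {0, 1, 2, 3} \<and>
     (if i = j then odd (p + q) else p \<noteq> q \<and> even (p + q))"
    unfolding verts_C4 using C4[of p q] by (cases "i = j") auto
  finally show ?thesis .
qed

lemma layer_indicator_FRAC:
  assumes "A0 \<subseteq> {1..k}" "A1 \<subseteq> {1..k}" "A2 \<subseteq> {1..k}"
    and "A1 \<inter> (A0 \<union> A2) = {}" "\<And>i j. i \<in> A0 \<Longrightarrow> j \<in> A2 \<Longrightarrow> i = j"
  shows "layer_indicator A0 A1 A2 \<in> FRAC (layered_graph k C4)"
proof -
  let ?X = "\<lambda>i p. p = 0 \<and> i \<in> A0 \<or> p = 1 \<and> i \<in> A1 \<or> p = (2 :: nat) \<and> i \<in> A2"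
  have edge: "layer_indicator A0 A1 A2 (i, p) + layer_indicator A0 A1 A2 (j, q) \<le> 1"
    if "{(i, p), (j, q)} \<in> edges (layered_graph k C4)" for i p j q
  proof -
    have "if i = j then odd (p + q) else p \<noteq> q \<and> even (p + q)"
      using that unfolding edges_layered_C4 by blast
    moreover have "i \<notin> A0" "i \<notin> A2" if "i \<in> A1" for i using that assms(4) by auto
    ultimately have no: "\<not> (?X i p \<and> ?X j q)"
      using assms(5)[of i j] assms(5)[of j i] by - (rule notI, elim conjE disjE; cases "i = j"; simp; blast)
    have ob: "of_bool A + of_bool B \<le> (1 :: real)" if "\<not> (A \<and> B)" for A B
      using that by (cases A) auto
    show ?thesis unfolding layer_indicator_def prod.case by (rule ob[OF no])
  qed
  have "layer_indicator A0 A1 A2 u + layer_indicator A0 A1 A2 v \<le> 1"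
    if "{u, v} \<in> edges (layered_graph k C4)" for u v
    using edge[of "fst u" "snd u" "fst v" "snd v"] that by simp
  moreover have "layer_indicator A0 A1 A2 \<in> coord_space (verts (layered_graph k C4))"
    using assms(1-3) by (force simp: coord_space_def verts_layered_C4 layer_indicator_def)
  moreover have "0 \<le> layer_indicator A0 A1 A2 u \<and> layer_indicator A0 A1 A2 u \<le> 1" for u
    by (simp add: layer_indicator_def split: prod.split)
  ultimately show ?thesis unfolding FRAC_def by blast
qed

text \<open>
  What one application of the operator needs from the previous relaxation \<open>P\<close>,
  besides the region of its layered points.
\<close>

locale stable_relaxation =
  fixes k :: nat and P :: "(nat \<times> nat \<Rightarrow> real) set"
  assumes convex: "convex P"
    and stable: "\<And>A0 A1 A2. A0 \<subseteq> {1..k} \<Longrightarrow> A1 \<subseteq> {1..k} \<Longrightarrow> A2 \<subseteq> {1..k} \<Longrightarrow>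
      A1 \<inter> (A0 \<union> A2) = {} \<Longrightarrow> (\<And>i j. i \<in> A0 \<Longrightarrow> j \<in> A2 \<Longrightarrow> i = j) \<Longrightarrow>
      layer_indicator A0 A1 A2 \<in> P"

lemma stable_relaxation_iterate:
  "stable_relaxation k ((LS_plus (verts (layered_graph k C4)) ^^ p) (FRAC (layered_graph k C4)))"
proof
  have fin: "finite (verts (layered_graph k C4))" by (simp add: verts_layered_C4)
  show "convex ((LS_plus (verts (layered_graph k C4)) ^^ p) (FRAC (layered_graph k C4)))"
    by (intro convex_LS_plus_iterate convex_FRAC fin)
  fix A0 A1 A2 :: "nat set"
  assume "A0 \<subseteq> {1..k}" "A1 \<subseteq> {1..k}" "A2 \<subseteq> {1..k}"
    "A1 \<inter> (A0 \<union> A2) = {}" "\<And>i j. i \<in> A0 \<Longrightarrow> j \<in> A2 \<Longrightarrow> i = j"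
  then have F: "layer_indicator A0 A1 A2 \<in> FRAC (layered_graph k C4)"
    by (rule layer_indicator_FRAC)
  then have "layer_indicator A0 A1 A2 \<in> coord_space (verts (layered_graph k C4))"
    unfolding FRAC_def by blast
  moreover have "layer_indicator A0 A1 A2 u \<in> {0, 1}" for u
    by (simp add: layer_indicator_def split: prod.split)
  ultimately show "layer_indicator A0 A1 A2 \<in>
      (LS_plus (verts (layered_graph k C4)) ^^ p) (FRAC (layered_graph k C4))"
    by (intro integral_point_in_LS_plus_iterate[OF fin F] ballI)
qed

section \<open>A symmetric lifting of a layered point\<close>

definition one_part :: "nat set \<Rightarrow> (nat \<times> nat) option \<Rightarrow> real" where
  "one_part T u = of_bool (u = None \<or> (\<exists>i \<in> T. u = Some (i, 1)))"

definition position_part :: "nat set \<Rightarrow> nat \<Rightarrow> (nat \<times> nat) option \<Rightarrow> real" where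
  "position_part S p u = of_bool (\<exists>i \<in> S. u = Some (i, p))"

definition layer_diff :: "nat \<Rightarrow> (nat \<times> nat) option \<Rightarrow> real" where
  "layer_diff i u = position_part {i} 0 u + position_part {i} 2 u - position_part {i} 1 u"

text \<open>
  The layers in \<open>S\<close> play symmetric roles, so the matrix has few free entries.
  Besides the values \<open>a\<close>, \<open>b\<close> on the diagonal, they are:
  \<open>c\<close> for the pairs $i_0, i_2$, the same \<open>c\<close> for $i_0, j_1$ and $i_2,
  j_1$, then \<open>a - c\<close> for $i_0, j_0$ and $i_2, j_2$, and \<open>f\<close> for $i_1,
  j_1$, with \<open>i \<noteq> j\<close>; entries at edges are 0. The choice of \<open>c\<close>
  and \<open>a - c\<close> makes the columns of $i_0$ and $i_2$ tight mixtures of stable sets.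
  Rows of fixed vertices in \<open>T\<close> repeat the row of the homogenizing coordinate. The
  definition writes these entries as a combination of products \<open>g u * h v\<close>, so that
  the quadratic form can be read off.
\<close>

definition lift_matrix ::
  "nat set \<Rightarrow> nat set \<Rightarrow> real \<Rightarrow> real \<Rightarrow> real \<Rightarrow> real \<Rightarrow> (nat \<times> nat) option \<Rightarrow> (nat \<times> nat) option \<Rightarrow> real" where
  "lift_matrix S T a b c f u v =
     (let e = one_part T; x0 = position_part S 0; x1 = position_part S 1; x2 = position_part S 2 in
       e u * e v + e u * (a * (x0 v + x2 v) + b * x1 v) + (a * (x0 u + x2 u) + b * x1 u) * e v
       + (a - c) * (x0 u * x0 v + x2 u * x2 v)
       + c * ((x0 u + x2 u) * x1 v + x1 u * (x0 v + x2 v)) + f * (x1 u * x1 v)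
       + c * (\<Sum>i\<in>S. layer_diff i u * layer_diff i v)
       + (b - c - f) * (\<Sum>i\<in>S. position_part {i} 1 u * position_part {i} 1 v))"

lemma position_part_eq: "finite S \<Longrightarrow> position_part S p u = (\<Sum>i\<in>S. position_part {i} p u)"
proof (cases u)
  case (Some v)
  assume "finite S"
  then show ?thesis
    using Some by (cases v; cases "snd v = p") (auto simp: position_part_def of_bool_def)
qed (simp add: position_part_def)

text \<open>
  Completing the square in \<open>z\<close> and replacing the sums of squares over the layers by
  their means (Cauchy-Schwarz) leaves a form in the two variables \<open>X0 + X2\<close> and
  \<open>X1\<close> alone. Multiplied by \<open>n\<close> it has the coefficients \<open>A /
  2\<close>, \<open>2 * B\<close> and \<open>C\<close>, hence the discriminant condition.
\<close>

lemma quadratic_form_nonneg: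
  fixes a b c f z :: real and x0 x1 x2 :: "'i \<Rightarrow> real"
  assumes S: "finite S" "S \<noteq> {}" and n: "n = real (card S)"
    and c: "0 \<le> c" "c \<le> a" and f: "f \<le> b - c"
    and A: "A = n * a * (1 - 2 * a) - (n - 2) * c" "A > 0"
    and B: "B = (n - 1) * c - n * a * b"
    and C: "C = b + (n - 1) * f - n * b\<^sup>2"
    and det: "2 * B\<^sup>2 \<le> A * C"
    and X: "X0 = sum x0 S" "X1 = sum x1 S" "X2 = sum x2 S"
  shows "0 \<le> z\<^sup>2 + 2 * z * (a * (X0 + X2) + b * X1) + (a - c) * (X0\<^sup>2 + X2\<^sup>2)
     + 2 * c * (X0 + X2) * X1 + f * X1\<^sup>2
     + c * (\<Sum>i\<in>S. (x0 i + x2 i - x1 i)\<^sup>2) + (b - c - f) * (\<Sum>i\<in>S. (x1 i)\<^sup>2)" (is "0 \<le> ?F")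
proof -
  have npos: "n > 0" using S n by (simp add: card_gt_0_iff)
  define s where "s = X0 + X2"
  have "0 \<le> (X0 - X2)\<^sup>2" by simp
  then have h1: "s\<^sup>2 / 2 \<le> X0\<^sup>2 + X2\<^sup>2"
    by (simp add: s_def power2_eq_square algebra_simps)
  have h2: "(s - X1)\<^sup>2 / n \<le> (\<Sum>i\<in>S. (x0 i + x2 i - x1 i)\<^sup>2)"
    using sum_squared_le_sum_of_squares[of "\<lambda>i. x0 i + x2 i - x1 i" S] npos
    by (simp add: s_def X n sum.distrib sum_subtractf field_simps)
  have h3: "X1\<^sup>2 / n \<le> (\<Sum>i\<in>S. (x1 i)\<^sup>2)"
    using sum_squared_le_sum_of_squares[of x1 S] npos by (simp add: X n field_simps)
  have q: "0 \<le> A * s\<^sup>2 / 2 + 2 * B * s * X1 + C * X1\<^sup>2"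
  proof -
    have "0 \<le> (A * s + 2 * B * X1)\<^sup>2 + 2 * (A * C - 2 * B\<^sup>2) * X1\<^sup>2"
      using det by simp
    also have "\<dots> = (2 * A) * (A * s\<^sup>2 / 2 + 2 * B * s * X1 + C * X1\<^sup>2)"
      by (simp add: power2_eq_square algebra_simps)
    finally show ?thesis using A(2) by (simp add: zero_le_mult_iff)
  qed
  have "0 \<le> (z + a * s + b * X1)\<^sup>2 + (A * s\<^sup>2 / 2 + 2 * B * s * X1 + C * X1\<^sup>2) / n"
    using q npos by simp
  also have "\<dots> = z\<^sup>2 + 2 * z * (a * s + b * X1) + (a - c) * (s\<^sup>2 / 2)
     + 2 * c * s * X1 + f * X1\<^sup>2 + c * ((s - X1)\<^sup>2 / n) + (b - c - f) * (X1\<^sup>2 / n)"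
    using npos by (simp add: A(1) B C field_simps power2_eq_square)
  also have "\<dots> \<le> z\<^sup>2 + 2 * z * (a * s + b * X1) + (a - c) * (X0\<^sup>2 + X2\<^sup>2)
     + 2 * c * s * X1 + f * X1\<^sup>2 + c * (\<Sum>i\<in>S. (x0 i + x2 i - x1 i)\<^sup>2)
     + (b - c - f) * (\<Sum>i\<in>S. (x1 i)\<^sup>2)"
    using c f by (intro add_mono order_refl mult_left_mono h1 h2 h3) auto
  finally show ?thesis by (simp add: s_def)
qed

text \<open>
  Each product \<open>g u * h v\<close> in the matrix contributes the product of two linear
  functionals \<open>L g\<close> and \<open>L h\<close> of \<open>z\<close> to the quadratic
  form, which becomes the one of \<open>quadratic_form_nonneg\<close>.
\<close>

lemma lift_matrix_psd:
  assumes V: "finite V" and S: "finite S" "S \<noteq> {}" "S \<times> {0, 1, 2} \<subseteq> V" and T: "T \<times> {1} \<subseteq> V"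
    and n: "n = real (card S)"
    and c: "0 \<le> c" "c \<le> a" and f: "f \<le> b - c"
    and A: "A = n * a * (1 - 2 * a) - (n - 2) * c" "A > 0"
    and B: "B = (n - 1) * c - n * a * b"
    and C: "C = b + (n - 1) * f - n * b\<^sup>2"
    and det: "2 * B\<^sup>2 \<le> A * C"
  shows "lift_matrix S T a b c f \<in> psd_matrices (index0 V)"
proof -
  let ?I = "index0 V" and ?Y = "lift_matrix S T a b c f"
  have out: "one_part T u = 0" "\<And>p. p \<in> {0, 1, 2} \<Longrightarrow> position_part S p u = 0"
    "\<And>p i. i \<in> S \<Longrightarrow> p \<in> {0, 1, 2} \<Longrightarrow> position_part {i} p u = 0" if "u \<notin> ?I" for u
    using that S T by (auto simp: one_part_def position_part_def index0_def)
  have diff_out: "layer_diff i u = 0" if "u \<notin> ?I" "i \<in> S" for u i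
    using out(3)[OF that] by (simp add: layer_diff_def)
  have "?Y u v = 0" if "u \<notin> ?I \<or> v \<notin> ?I" for u v
    using that by (auto simp: lift_matrix_def out diff_out)
  moreover have "?Y u v = ?Y v u" for u v
    by (simp add: lift_matrix_def Let_def algebra_simps)
  moreover have "0 \<le> (\<Sum>u\<in>?I. z u * mat_vec ?I ?Y z u)" for z
  proof -
    define L where "L = (\<lambda>g. \<Sum>u\<in>?I. z u * g u)"
    have L_lin: "L (\<lambda>u. g u + h u) = L g + L h" "L (\<lambda>u. g u - h u) = L g - L h"
      "L (\<lambda>u. r * g u) = r * L g" "L (\<lambda>u. \<Sum>i\<in>S. G i u) = (\<Sum>i\<in>S. L (G i))" for g h r G
      by (simp_all add: L_def sum.distrib sum_subtractf algebra_simps sum_distrib_left sum.swap[of _ ?I])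
    define e x0 x1 x2 where "e = one_part T" and "x0 = position_part S 0" and "x1 = position_part S 1"
      and "x2 = position_part S 2"
    define d y where "d = layer_diff" and "y = (\<lambda>i. position_part {i} 1)"
    define F where "F = (\<lambda>Z. \<Sum>u\<in>?I. \<Sum>v\<in>?I. z u * (Z u v * z v))"
    have F_rank1: "F (\<lambda>u v. g u * h v) = L g * L h" for g h
      by (simp add: F_def L_def sum_product mult_ac)
    have F_lin: "F (\<lambda>u v. Z u v + Z' u v) = F Z + F Z'" "F (\<lambda>u v. r * Z u v) = r * F Z" for Z Z' r
      by (simp_all add: F_def sum.distrib algebra_simps sum_distrib_left)
    have F_sum: "F (\<lambda>u v. \<Sum>i\<in>S. G i u v) = (\<Sum>i\<in>S. F (G i))" for G
    proof -
      have "F (\<lambda>u v. \<Sum>i\<in>S. G i u v) = (\<Sum>u\<in>?I. \<Sum>v\<in>?I. \<Sum>i\<in>S. z u * (G i u v * z v))"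
        by (simp add: F_def sum_distrib_left sum_distrib_right)
      also have "\<dots> = (\<Sum>u\<in>?I. \<Sum>i\<in>S. \<Sum>v\<in>?I. z u * (G i u v * z v))"
        by (intro sum.cong refl sum.swap)
      also have "\<dots> = (\<Sum>i\<in>S. F (G i))" unfolding F_def by (rule sum.swap)
      finally show ?thesis .
    qed
    have Y_eq: "?Y = (\<lambda>u v. e u * e v + e u * (a * (x0 v + x2 v) + b * x1 v)
       + (a * (x0 u + x2 u) + b * x1 u) * e v
       + (a - c) * (x0 u * x0 v + x2 u * x2 v)
       + c * ((x0 u + x2 u) * x1 v + x1 u * (x0 v + x2 v)) + f * (x1 u * x1 v)
       + c * (\<Sum>i\<in>S. d i u * d i v) + (b - c - f) * (\<Sum>i\<in>S. y i u * y i v))"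
      by (simp add: fun_eq_iff lift_matrix_def Let_def e_def x0_def x1_def x2_def d_def y_def)
    have "(\<Sum>u\<in>?I. z u * mat_vec ?I ?Y z u) = F ?Y"
      by (simp add: F_def mat_vec_def sum_distrib_left)
    also have "\<dots> = (L e)\<^sup>2 + 2 * L e * (a * (L x0 + L x2) + b * L x1)
       + (a - c) * ((L x0)\<^sup>2 + (L x2)\<^sup>2) + 2 * c * (L x0 + L x2) * L x1 + f * (L x1)\<^sup>2
       + c * (\<Sum>i\<in>S. (L (d i))\<^sup>2) + (b - c - f) * (\<Sum>i\<in>S. (L (y i))\<^sup>2)"
      unfolding Y_eq F_lin F_sum F_rank1[of e e] F_rank1[of x1 x1] F_rank1[of x0 x0] F_rank1[of x2 x2]
        F_rank1[of "d _" "d _"] F_rank1[of "y _" "y _"]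
        F_rank1[of e "\<lambda>v. a * (x0 v + x2 v) + b * x1 v"]
        F_rank1[of "\<lambda>v. a * (x0 v + x2 v) + b * x1 v" e]
        F_rank1[of x1 "\<lambda>v. x0 v + x2 v"] F_rank1[of "\<lambda>v. x0 v + x2 v" x1] L_lin
      by (simp add: power2_eq_square algebra_simps)
    also have "0 \<le> \<dots>"
    proof -
      have Lx: "L (position_part S p) = (\<Sum>i\<in>S. L (position_part {i} p))" for p
      proof -
        have "position_part S p = (\<lambda>u. \<Sum>i\<in>S. position_part {i} p u)"
          by (rule ext) (rule position_part_eq[OF S(1)])
        then show ?thesis by (simp only: L_lin(4))
      qed
      have Ld: "L (d i) = L (position_part {i} 0) + L (position_part {i} 2) - L (position_part {i} 1)" for i
        unfolding d_def layer_diff_def[abs_def] L_lin ..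
      show ?thesis
        unfolding Ld y_def x0_def x1_def x2_def
        by (rule quadratic_form_nonneg[OF S(1,2) n c f A B C det Lx Lx Lx])
    qed
    finally show ?thesis .
  qed
  ultimately show ?thesis unfolding psd_matrices_def by blast
qed

section \<open>The columns of the lifting\<close>

lemma layer_diff_sum:
  assumes "finite S" "j \<in> S"
  shows "(\<Sum>i\<in>S. layer_diff i u * layer_diff i (Some (j, q))) = layer_diff j u * layer_diff j (Some (j, q))"
    and "(\<Sum>i\<in>S. position_part {i} 1 u * position_part {i} 1 (Some (j, q))) =
      position_part {j} 1 u * position_part {j} 1 (Some (j, q))"
  using assms by (simp_all add: sum.remove layer_diff_def position_part_def)

lemma layer_diff_sum_zero:
  assumes "j \<notin> S"
  shows "(\<Sum>i\<in>S. layer_diff i u * layer_diff i (Some (j, q))) = 0"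
    and "(\<Sum>i\<in>S. position_part {i} 1 u * position_part {i} 1 (Some (j, q))) = 0"
  using assms by (auto intro!: sum.neutral simp: layer_diff_def position_part_def)

lemma lift_matrix_None:
  "lift_matrix S T a b c f u None =
     one_part T u + a * (position_part S 0 u + position_part S 2 u) + b * position_part S 1 u"
  by (simp add: lift_matrix_def Let_def one_part_def position_part_def layer_diff_def)

lemma lift_matrix_column:
  assumes "finite S" "j \<in> S" "j \<notin> T"
  shows "lift_matrix S T a b c f u (Some (j, 0)) =
      a * one_part T u + (a - c) * position_part S 0 u + c * position_part S 1 u + c * layer_diff j u"
    and "lift_matrix S T a b c f u (Some (j, 2)) =
      a * one_part T u + (a - c) * position_part S 2 u + c * position_part S 1 u + c * layer_diff j u"
    and "lift_matrix S T a b c f u (Some (j, 1)) =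
      b * one_part T u + c * (position_part S 0 u + position_part S 2 u) + f * position_part S 1 u
      - c * layer_diff j u + (b - c - f) * position_part {j} 1 u"
  unfolding lift_matrix_def Let_def layer_diff_sum[OF assms(1,2)]
  using assms by (simp_all add: one_part_def position_part_def layer_diff_def)

lemma lift_matrix_column_fixed:
  assumes "j \<in> T" "j \<notin> S"
  shows "lift_matrix S T a b c f u (Some (j, 1)) = lift_matrix S T a b c f u None"
  unfolding lift_matrix_None unfolding lift_matrix_def Let_def layer_diff_sum_zero[OF assms(2)]
  using assms by (simp add: one_part_def position_part_def)

lemma lift_matrix_column_zero:
  assumes "\<not> (j \<in> S \<and> q \<in> {0, 1, 2})" "\<not> (j \<in> T \<and> q = 1)"
  shows "lift_matrix S T a b c f u (Some (j, q)) = 0"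
proof -
  have "position_part {i} p (Some (j, q)) = 0" if "i \<in> S" "p \<in> {0, 1, 2}" for i p
    using that assms by (auto simp: position_part_def)
  then have "layer_diff i (Some (j, q)) = 0" "position_part {i} 1 (Some (j, q)) = 0" if "i \<in> S" for i
    using that by (auto simp: layer_diff_def)
  moreover have "one_part T (Some (j, q)) = 0" "position_part S 0 (Some (j, q)) = 0"
    "position_part S 1 (Some (j, q)) = 0" "position_part S 2 (Some (j, q)) = 0"
    using assms by (auto simp: one_part_def position_part_def)
  ultimately show ?thesis by (simp add: lift_matrix_def Let_def)
qed

lemma lift_matrix_diagonal:
  assumes "finite S" "S \<inter> T = {}"
  shows "lift_matrix S T a b c f u u = lift_matrix S T a b c f u None"
proof (cases u)
  case (Some v)
  obtain j q where v: "v = (j, q)" by (cases v)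
  show ?thesis
  proof (cases "j \<in> S \<and> q \<in> {0, 1, 2}")
    case True
    then have "j \<notin> T" using assms(2) by auto
    from True consider "j \<in> S" "q = 0" | "j \<in> S" "q = 1" | "j \<in> S" "q = 2" by auto
    then show ?thesis
      using assms(1) \<open>j \<notin> T\<close> unfolding Some v
      by cases (simp_all add: lift_matrix_column lift_matrix_None one_part_def position_part_def layer_diff_def
          del: One_nat_def)
  next
    case nS: False
    show ?thesis
    proof (cases "j \<in> T \<and> q = 1")
      case True
      then have "j \<in> T" "j \<notin> S" and q: "q = 1" using assms(2) by auto
      then show ?thesis unfolding Some v q by (intro lift_matrix_column_fixed)
    next
      case False
      then have "lift_matrix S T a b c f u None = 0"
        using nS by (auto simp: Some v lift_matrix_None one_part_def position_part_def)
      then show ?thesis using lift_matrix_column_zero[OF nS False] by (simp add: Some v)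
    qed
  qed
qed simp

text \<open>
  With the membership of the layer decided, an entry of a column depends on the position in the
  layer only.
\<close>

lemma layer_index_cases:
  assumes "S \<inter> T = {}" "j \<in> S"
  obtains "u = None" | p where "u = Some (j, p)" "j \<in> S" "j \<notin> T"
    | i p where "u = Some (i, p)" "i \<in> S" "i \<notin> T" "i \<noteq> j"
    | i p where "u = Some (i, p)" "i \<notin> S" "i \<in> T" "i \<noteq> j"
    | i p where "u = Some (i, p)" "i \<notin> S" "i \<notin> T" "i \<noteq> j"
proof (cases u)
  case (Some v)
  obtain i p where "u = Some (i, p)" using Some by (cases v) auto
  then show ?thesis
    using that(2)[of p] that(3-5)[of i p] assms by (cases "i = j"; cases "i \<in> S"; cases "i \<in> T") auto
qed (rule that(1))

text \<open>
  Conditioning in probabilistic terms. If $j_0$ is chosen, then either $j_2$ is chosen as well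
  and all other layers use their middle vertex, or all layers use position 0. If $j_1$ is
  chosen, a layered point on one layer fewer remains. If $j_0$ is not chosen, then with weight
  \<open>a - c\<close> all layers use position 2, and the remaining weight \<open>M\<close> is
  spread over a layered point on one layer fewer, with $j_1$ chosen for the part
  \<open>b\<close> of it. If $j_1$ is not chosen, stable sets suffice.
\<close>

lemma lift_matrix_columns_as_combinations:
  fixes S T :: "nat set" and a b c f :: real
  defines "Y \<equiv> lift_matrix S T a b c f"
  assumes S: "finite S" "S \<inter> T = {}"
  shows "(\<lambda>u. Y u None) = homog 1 (layer_point S T a b)"
    and "j \<in> S \<Longrightarrow> (\<lambda>u. Y u (Some (j, 0))) =
      c *\<^sub>R homog 1 (layer_indicator {j} (T \<union> (S - {j})) {j}) + (a - c) *\<^sub>R homog 1 (layer_indicator S T {})"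
    and "j \<in> S \<Longrightarrow> (\<lambda>u. Y u (Some (j, 2))) =
      c *\<^sub>R homog 1 (layer_indicator {j} (T \<union> (S - {j})) {j}) + (a - c) *\<^sub>R homog 1 (layer_indicator {} T S)"
    and "j \<in> S \<Longrightarrow> b > 0 \<Longrightarrow> (\<lambda>u. Y u (Some (j, 1))) =
      b *\<^sub>R homog 1 (layer_point (S - {j}) (insert j T) (c / b) (f / b))"
    and "j \<in> S \<Longrightarrow> M = 1 - 2 * a + c \<Longrightarrow> M > 0 \<Longrightarrow> (\<lambda>u. Y u None - Y u (Some (j, 0))) =
      (a - c) *\<^sub>R homog 1 (layer_indicator {} T S)
      + (b *\<^sub>R homog 1 (layer_point (S - {j}) (insert j T) (c / M) ((b - c) / M))
      + (M - b) *\<^sub>R homog 1 (layer_point (S - {j}) T (c / M) ((b - c) / M)))"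
    and "j \<in> S \<Longrightarrow> M = 1 - 2 * a + c \<Longrightarrow> M > 0 \<Longrightarrow> (\<lambda>u. Y u None - Y u (Some (j, 2))) =
      (a - c) *\<^sub>R homog 1 (layer_indicator S T {})
      + (b *\<^sub>R homog 1 (layer_point (S - {j}) (insert j T) (c / M) ((b - c) / M))
      + (M - b) *\<^sub>R homog 1 (layer_point (S - {j}) T (c / M) ((b - c) / M)))"
    and "j \<in> S \<Longrightarrow> (\<lambda>u. Y u None - Y u (Some (j, 1))) =
      c *\<^sub>R homog 1 (layer_indicator {j} (T \<union> (S - {j})) {j})
      + ((a - c) *\<^sub>R homog 1 (layer_indicator S T {}) + ((a - c) *\<^sub>R homog 1 (layer_indicator {} T S)
      + ((b - f - c) *\<^sub>R homog 1 (layer_indicator {} (T \<union> (S - {j})) {})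
      + (1 - 2 * a - 2 * b + 2 * c + f) *\<^sub>R homog 1 (layer_indicator {} T {}))))"
proof -
  note features = one_part_def position_part_def layer_diff_def layer_indicator_def layer_point_def
  have M: "b * (x / M) + (M - b) * (x / M) = x" if "M > 0" for M x :: real
    using that by (simp add: field_simps)
  have disj: "i \<in> S \<Longrightarrow> i \<notin> T" for i using S by auto
  show "(\<lambda>u. Y u None) = homog 1 (layer_point S T a b)"
  proof
    fix u show "Y u None = homog 1 (layer_point S T a b) u"
      unfolding Y_def lift_matrix_None
      by (cases u) (use disj in \<open>auto simp: features\<close>)
  qed
  assume j: "j \<in> S"
  note cs = layer_index_cases[OF S(2) j]
  note col = lift_matrix_column[OF S(1) j disj[OF j]]
  show "(\<lambda>u. Y u (Some (j, 0))) =
      c *\<^sub>R homog 1 (layer_indicator {j} (T \<union> (S - {j})) {j}) + (a - c) *\<^sub>R homog 1 (layer_indicator S T {})"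
  proof
    fix u show "Y u (Some (j, 0)) = (c *\<^sub>R homog 1 (layer_indicator {j} (T \<union> (S - {j})) {j}) + (a - c) *\<^sub>R homog 1 (layer_indicator S T {})) u"
      unfolding Y_def col
      by (cases u rule: cs) (use j in \<open>auto simp: features of_bool_def\<close>)
  qed
  show "(\<lambda>u. Y u (Some (j, 2))) =
      c *\<^sub>R homog 1 (layer_indicator {j} (T \<union> (S - {j})) {j}) + (a - c) *\<^sub>R homog 1 (layer_indicator {} T S)"
  proof
    fix u show "Y u (Some (j, 2)) = (c *\<^sub>R homog 1 (layer_indicator {j} (T \<union> (S - {j})) {j}) + (a - c) *\<^sub>R homog 1 (layer_indicator {} T S)) u"
      unfolding Y_def col
      by (cases u rule: cs) (use j in \<open>auto simp: features of_bool_def\<close>)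
  qed
  show "(\<lambda>u. Y u (Some (j, 1))) = b *\<^sub>R homog 1 (layer_point (S - {j}) (insert j T) (c / b) (f / b))"
    if "b > 0"
  proof
    fix u show "Y u (Some (j, 1)) = (b *\<^sub>R homog 1 (layer_point (S - {j}) (insert j T) (c / b) (f / b))) u"
      unfolding Y_def col
      by (cases u rule: cs) (use that in \<open>auto simp: features of_bool_def\<close>)
  qed
  show "(\<lambda>u. Y u None - Y u (Some (j, 1))) =
      c *\<^sub>R homog 1 (layer_indicator {j} (T \<union> (S - {j})) {j})
      + ((a - c) *\<^sub>R homog 1 (layer_indicator S T {}) + ((a - c) *\<^sub>R homog 1 (layer_indicator {} T S)
      + ((b - f - c) *\<^sub>R homog 1 (layer_indicator {} (T \<union> (S - {j})) {})
      + (1 - 2 * a - 2 * b + 2 * c + f) *\<^sub>R homog 1 (layer_indicator {} T {}))))" (is "_ = ?R")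
  proof
    fix u show "Y u None - Y u (Some (j, 1)) = ?R u"
      unfolding Y_def col lift_matrix_None
      by (cases u rule: cs) (use j in \<open>auto simp: features of_bool_def\<close>)
  qed
  assume Mdef: "M = 1 - 2 * a + c" and Mpos: "M > 0"
  show "(\<lambda>u. Y u None - Y u (Some (j, 0))) =
      (a - c) *\<^sub>R homog 1 (layer_indicator {} T S)
      + (b *\<^sub>R homog 1 (layer_point (S - {j}) (insert j T) (c / M) ((b - c) / M))
      + (M - b) *\<^sub>R homog 1 (layer_point (S - {j}) T (c / M) ((b - c) / M)))" (is "_ = ?R")
  proof
    fix u show "Y u None - Y u (Some (j, 0)) = ?R u"
      unfolding Y_def col lift_matrix_None
      by (cases u rule: cs) (use M[OF Mpos] Mdef in \<open>auto simp: features of_bool_def\<close>)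
  qed
  show "(\<lambda>u. Y u None - Y u (Some (j, 2))) =
      (a - c) *\<^sub>R homog 1 (layer_indicator S T {})
      + (b *\<^sub>R homog 1 (layer_point (S - {j}) (insert j T) (c / M) ((b - c) / M))
      + (M - b) *\<^sub>R homog 1 (layer_point (S - {j}) T (c / M) ((b - c) / M)))" (is "_ = ?R")
  proof
    fix u show "Y u None - Y u (Some (j, 2)) = ?R u"
      unfolding Y_def col lift_matrix_None
      by (cases u rule: cs) (use M[OF Mpos] Mdef in \<open>auto simp: features of_bool_def\<close>)
  qed
qed

section \<open>One application of the operator to layered points\<close>

lemma point_regionI:
  assumes "\<And>S T. S \<subseteq> {1..k} \<Longrightarrow> T \<subseteq> {1..k} \<Longrightarrow> S \<inter> T = {} \<Longrightarrow> card S = n \<Longrightarrow> layer_point S T a b \<in> P"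
  shows "(a, b) \<in> point_region k P n"
  using assms unfolding point_region_def by simp

lemma point_regionD:
  assumes "(a, b) \<in> point_region k P n" "S \<subseteq> {1..k}" "T \<subseteq> {1..k}" "S \<inter> T = {}" "card S = n"
  shows "layer_point S T a b \<in> P"
  using assms unfolding point_region_def by simp

lemma sum_fun_apply: "(\<Sum>i\<in>S. g i) x = (\<Sum>i\<in>S. g i x)" for g :: "'i \<Rightarrow> 'b \<Rightarrow> real"
  by (induction S rule: infinite_finite_induct) auto

context stable_relaxation
begin

lemma homog_cone_indicator:
  assumes "A0 \<subseteq> {1..k}" "A1 \<subseteq> {1..k}" "A2 \<subseteq> {1..k}" "A1 \<inter> (A0 \<union> A2) = {}"
    "\<And>i j. i \<in> A0 \<Longrightarrow> j \<in> A2 \<Longrightarrow> i = j" "0 \<le> t"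
  shows "t *\<^sub>R homog 1 (layer_indicator A0 A1 A2) \<in> homog_cone P"
  using assms by (intro homog_cone_memI stable) auto

lemma homog_cone_layer_point:
  assumes "(a, b) \<in> point_region k P n" "S \<subseteq> {1..k}" "T \<subseteq> {1..k}" "S \<inter> T = {}" "card S = n" "0 \<le> t"
  shows "t *\<^sub>R homog 1 (layer_point S T a b) \<in> homog_cone P"
  by (rule homog_cone_memI[OF point_regionD[OF assms(1-5)] assms(6)])

text \<open>
  The pair \<open>(c / b, f / b)\<close> describes the point left when a middle vertex is fixed
  to 1, the pair \<open>(c / M, (b - c) / M)\<close> the one left when an outer vertex is fixed
  to 0. The linear inequalities on \<open>a, b, c, f\<close> say that all weights in the columns
  are nonnegative.
\<close>

lemma point_region_LS_plus:
  fixes n :: nat and a b c f M A B C :: real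
  assumes n: "1 \<le> n"
    and c: "0 \<le> c" "c \<le> a" and b: "0 < b" "b \<le> M" and M: "M = 1 - 2 * a + c"
    and f: "f \<le> b - c" "2 * a + 2 * b - 2 * c - f \<le> 1"
    and A: "A = real n * a * (1 - 2 * a) - (real n - 2) * c" "A > 0"
    and B: "B = (real n - 1) * c - real n * a * b"
    and C: "C = b + (real n - 1) * f - real n * b\<^sup>2"
    and det: "2 * B\<^sup>2 \<le> A * C"
    and on: "(c / b, f / b) \<in> point_region k P (n - 1)"
    and off: "(c / M, (b - c) / M) \<in> point_region k P (n - 1)"
  shows "(a, b) \<in> point_region k (LS_plus (verts (layered_graph k C4)) P) n"
proof (rule point_regionI)
  fix S T :: "nat set"
  assume ST: "S \<subseteq> {1..k}" "T \<subseteq> {1..k}" "S \<inter> T = {}" "card S = n"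
  let ?V = "verts (layered_graph k C4)" and ?Y = "lift_matrix S T a b c f"
  have fin: "finite S" using ST(1) finite_subset by blast
  have ne: "S \<noteq> {}" using n ST(4) by auto
  have finV: "finite ?V" by (simp add: verts_layered_C4)
  have Mpos: "M > 0" using b by simp
  have psd: "?Y \<in> psd_matrices (index0 ?V)"
    by (rule lift_matrix_psd[OF finV fin ne _ _ _ c f(1) A B C det])
      (use ST in \<open>auto simp: verts_layered_C4\<close>)
  note cols = lift_matrix_columns_as_combinations[OF fin ST(3), where a = a and b = b and c = c and f = f]
  have sub: "S - {j} \<subseteq> {1..k}" "insert j T \<subseteq> {1..k}" "(S - {j}) \<inter> insert j T = {}"
    "(S - {j}) \<inter> T = {}" "card (S - {j}) = n - 1" if "j \<in> S" for j
    using that ST fin by auto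
  have ind: "t *\<^sub>R homog 1 (layer_indicator {j} (T \<union> (S - {j})) {j}) \<in> homog_cone P"
    "t *\<^sub>R homog 1 (layer_indicator S T {}) \<in> homog_cone P"
    "t *\<^sub>R homog 1 (layer_indicator {} T S) \<in> homog_cone P"
    "t *\<^sub>R homog 1 (layer_indicator {} (T \<union> (S - {j})) {}) \<in> homog_cone P"
    "t *\<^sub>R homog 1 (layer_indicator {} T {}) \<in> homog_cone P"
    if "j \<in> S" "0 \<le> t" for j t
    using that ST by (auto intro!: homog_cone_indicator)
  have lp: "t *\<^sub>R homog 1 (layer_point (S - {j}) (insert j T) x y) \<in> homog_cone P"
    "t *\<^sub>R homog 1 (layer_point (S - {j}) T x y) \<in> homog_cone P"
    if "j \<in> S" "0 \<le> t" "(x, y) \<in> point_region k P (n - 1)" for j t x y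
    using homog_cone_layer_point[OF that(3) sub(1)[OF that(1)] _ _ sub(5)[OF that(1)] that(2)]
      sub[OF that(1)] ST(2) by auto
  note add = homog_cone_add[OF convex]
  have active: "(\<lambda>u. ?Y u (Some (j, p))) \<in> homog_cone P \<and>
      (\<lambda>u. ?Y u None - ?Y u (Some (j, p))) \<in> homog_cone P" if j: "j \<in> S" and p: "p \<in> {0, 1, 2}" for j p
  proof -
    have w: "0 \<le> c" "0 \<le> a - c" "0 \<le> b" "0 \<le> M - b" "0 \<le> b - f - c"
      "0 \<le> 1 - 2 * a - 2 * b + 2 * c + f" using b c f by auto
    consider "p = 0" | "p = 2" | "p = 1" using p by auto
    then show ?thesis
    proof cases
      case 1
      show ?thesis
        unfolding 1 cols(2)[OF j] cols(5)[OF j M Mpos]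
        by (intro conjI add ind[OF j] lp[OF j] w off)
    next
      case 2
      show ?thesis
        unfolding 2 cols(3)[OF j] cols(6)[OF j M Mpos]
        by (intro conjI add ind[OF j] lp[OF j] w off)
    next
      case 3
      show ?thesis
        unfolding 3 cols(4)[OF j b(1)] cols(7)[OF j]
        by (intro conjI add ind[OF j] lp[OF j] w on)
    qed
  qed
  obtain j where j: "j \<in> S" using ne by auto
  have col0: "(\<lambda>u. ?Y u None) \<in> homog_cone P"
    using add[OF conjunct1[OF active[OF j, of 0]] conjunct2[OF active[OF j, of 0]]]
    by (simp add: plus_fun_def)
  have zero: "(\<lambda>u. 0) \<in> homog_cone P"
    using homog_cone_zero[of P] stable[of "{}" "{}" "{}"] by (auto simp: zero_fun_def)
  have all: "(\<lambda>u. ?Y u (Some v)) \<in> homog_cone P \<and> (\<lambda>u. ?Y u None - ?Y u (Some v)) \<in> homog_cone P" for v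
  proof -
    obtain i p where v: "v = (i, p)" by (cases v)
    consider "i \<in> S" "p \<in> {0, 1, 2}" | "i \<in> T" "i \<notin> S" "p = 1"
      | "\<not> (i \<in> S \<and> p \<in> {0, 1, 2})" "\<not> (i \<in> T \<and> p = 1)" using ST(3) by blast
    then show ?thesis
    proof cases
      case 1
      then show ?thesis unfolding v by (rule active)
    next
      case 2
      show ?thesis
        unfolding v 2(3) lift_matrix_column_fixed[OF 2(1,2)] using col0 zero by simp
    next
      case 3
      show ?thesis unfolding v lift_matrix_column_zero[OF 3] using col0 zero by simp
    qed
  qed
  show "layer_point S T a b \<in> LS_plus ?V P"
    unfolding LS_plus_iff[OF finV]
    using psd cols(1) lift_matrix_diagonal[OF fin ST(3)] all by blast
qed

subsection \<open>The planar region of layered points\<close>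

lemma convex_point_region: "convex (point_region k P n)"
proof (rule convexI)
  fix x y :: "real \<times> real" and s t :: real
  assume x: "x \<in> point_region k P n" and y: "y \<in> point_region k P n" and st: "0 \<le> s" "0 \<le> t" "s + t = 1"
  obtain a b a' b' where xy: "x = (a, b)" "y = (a', b')" by (cases x; cases y)
  have "layer_point S T (s * a + t * a') (s * b + t * b') =
      s *\<^sub>R layer_point S T a b + t *\<^sub>R layer_point S T a' b'" for S T
    using st by (auto simp: layer_point_def fun_eq_iff)
  then have "layer_point S T (s * a + t * a') (s * b + t * b') \<in> P"
    if "layer_point S T a b \<in> P" "layer_point S T a' b' \<in> P" for S T
    using convexD[OF convex that st] by simp
  then have "(s * a + t * a', s * b + t * b') \<in> point_region k P n"
    using x y unfolding xy by (intro point_regionI) (metis point_regionD)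
  moreover have "s *\<^sub>R x + t *\<^sub>R y = (s * a + t * a', s * b + t * b')" by (simp add: xy)
  ultimately show "s *\<^sub>R x + t *\<^sub>R y \<in> point_region k P n" by simp
qed

text \<open>
  Average over \<open>i \<in> S\<close> of the stable sets that contain $i_0$ and $i_2$ and the
  middle vertices of the other layers.
\<close>

lemma vertex_in_point_region:
  assumes "1 \<le> n"
  shows "(1 / real n, 1 - 1 / real n) \<in> point_region k P n"
proof (rule point_regionI)
  fix S T :: "nat set"
  assume ST: "S \<subseteq> {1..k}" "T \<subseteq> {1..k}" "S \<inter> T = {}" "card S = n"
  have fin: "finite S" using ST(1) finite_subset by blast
  have n: "real n > 0" using assms by simp
  have disj: "j \<in> S \<Longrightarrow> j \<notin> T" for j using ST(3) by auto
  let ?x = "\<lambda>i. layer_indicator {i} (T \<union> (S - {i})) {i}"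
  have "(\<Sum>i\<in>S. (1 / real n) *\<^sub>R ?x i) \<in> P"
    using ST n by (intro convex_sum[OF fin convex] stable) auto
  also have "(\<Sum>i\<in>S. (1 / real n) *\<^sub>R ?x i) = layer_point S T (1 / n) (1 - 1 / n)"
  proof
    fix v :: "nat \<times> nat"
    obtain j p where v: "v = (j, p)" by (cases v)
    show "(\<Sum>i\<in>S. (1 / real n) *\<^sub>R ?x i) v = layer_point S T (1 / n) (1 - 1 / n) v"
    proof (cases "j \<in> S")
      case True
      have "(\<Sum>i\<in>S. (1 / real n) *\<^sub>R ?x i) v = (1 / n) * ?x j v + (\<Sum>i\<in>S - {j}. (1 / n) * ?x i v)"
        unfolding sum_fun_apply using fin True by (simp add: sum.remove)
      also have "(\<Sum>i\<in>S - {j}. (1 / n) * ?x i v) = (\<Sum>i\<in>S - {j}. (1 / n) * of_bool (p = 1))"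
        using True by (intro sum.cong) (auto simp: layer_indicator_def v)
      also have "\<dots> = (1 - 1 / real n) * of_bool (p = 1)"
        using True fin ST(4) assms n by (simp add: of_nat_diff diff_divide_distrib)
      finally show ?thesis
        by (rule trans) (use True n disj in \<open>cases "p = 1"; simp add: v layer_indicator_def layer_point_def\<close>)
    next
      case False
      then have "(\<Sum>i\<in>S. (1 / real n) *\<^sub>R ?x i) v = (\<Sum>i\<in>S. (1 / n) * of_bool (p = 1 \<and> j \<in> T))"
        unfolding sum_fun_apply by (intro sum.cong) (auto simp: layer_indicator_def v)
      also have "\<dots> = of_bool (p = 1 \<and> j \<in> T)" using n ST(4) by simp
      finally show ?thesis
        by (rule trans) (use False in \<open>auto simp: layer_point_def v\<close>)
    qed
  qed
  finally show "layer_point S T (1 / n) (1 - 1 / n) \<in> P" .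
qed

text \<open>
  Mix the stable sets that use position 0, respectively position 2, in all layers of
  \<open>S\<close>, and the one that avoids \<open>S\<close>.
\<close>

lemma bottom_in_point_region:
  assumes "0 \<le> a" "a \<le> 1 / 2"
  shows "(a, 0) \<in> point_region k P n"
proof (rule point_regionI)
  fix S T :: "nat set"
  assume ST: "S \<subseteq> {1..k}" "T \<subseteq> {1..k}" "S \<inter> T = {}" "card S = n"
  have P: "layer_indicator S T {} \<in> P" "layer_indicator {} T S \<in> P" "layer_indicator {} T {} \<in> P"
    using ST by (auto intro!: stable)
  have "(1 / 2) *\<^sub>R layer_indicator S T {} + (1 / 2) *\<^sub>R layer_indicator {} T S \<in> P"
    by (rule convexD[OF convex P(1,2)]) auto
  then have "(2 * a) *\<^sub>R ((1 / 2) *\<^sub>R layer_indicator S T {} + (1 / 2) *\<^sub>R layer_indicator {} T S)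
      + (1 - 2 * a) *\<^sub>R layer_indicator {} T {} \<in> P"
    using assms by (intro convexD[OF convex _ P(3)]) auto
  also have "(2 * a) *\<^sub>R ((1 / 2) *\<^sub>R layer_indicator S T {} + (1 / 2) *\<^sub>R layer_indicator {} T S)
      + (1 - 2 * a) *\<^sub>R layer_indicator {} T {} = layer_point S T a 0"
    using ST(3) by (auto simp: fun_eq_iff layer_indicator_def layer_point_def)
  finally show "layer_point S T a 0 \<in> P" .
qed

end

text \<open>
  The strength of a relaxation is measured by the slope \<open>-m\<close> with which its region
  leaves the vertex \<open>(1 / n, 1 - 1 / n)\<close>. The bound on \<open>\<epsilon>\<close>
  keeps the first coordinate at most \<open>1 / 2\<close>, as
  \<open>bottom_in_point_region\<close> requires.
\<close>

definition leaves_vertex :: "nat \<Rightarrow> (nat \<times> nat \<Rightarrow> real) set \<Rightarrow> nat \<Rightarrow> real \<Rightarrow> bool" where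
  "leaves_vertex k P n m \<longleftrightarrow> (\<exists>\<epsilon>. 0 < \<epsilon> \<and> \<epsilon> \<le> 1 / 2 - 1 / real n \<and>
     (1 / real n + \<epsilon>, 1 - 1 / real n - m * \<epsilon>) \<in> point_region k P n)"

context stable_relaxation
begin

text \<open>
  The region contains the triangle spanned by the vertex, the given point and the points below
  them with second coordinate 0.
\<close>

lemma point_region_below:
  assumes n: "1 \<le> n" and \<epsilon>: "0 < \<epsilon>" "\<epsilon> \<le> 1 / 2 - 1 / real n"
    and top: "(1 / real n + \<epsilon>, 1 - 1 / real n - m * \<epsilon>) \<in> point_region k P n"
    and x: "0 \<le> x" "x \<le> \<epsilon>" and y: "m * x \<le> y" "y \<le> 1 - 1 / real n"
  shows "(1 / real n + x, 1 - 1 / real n - y) \<in> point_region k P n"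
proof -
  define v where "v = 1 / real n"
  define \<beta> where "\<beta> = 1 - v - m * x"
  have "(1 - x / \<epsilon>) *\<^sub>R (v, 1 - v) + (x / \<epsilon>) *\<^sub>R (v + \<epsilon>, 1 - v - m * \<epsilon>) \<in> point_region k P n"
    using \<epsilon>(1) x vertex_in_point_region[OF n] top
    by (intro convexD[OF convex_point_region]) (auto simp: v_def)
  also have "(1 - x / \<epsilon>) *\<^sub>R (v, 1 - v) + (x / \<epsilon>) *\<^sub>R (v + \<epsilon>, 1 - v - m * \<epsilon>) = (v + x, \<beta>)"
    using \<epsilon>(1) by (simp add: \<beta>_def field_simps)
  finally have 1: "(v + x, \<beta>) \<in> point_region k P n" .
  have 2: "(v + x, 0) \<in> point_region k P n"
    using x \<epsilon> by (intro bottom_in_point_region) (auto simp: v_def)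
  have \<beta>: "0 \<le> 1 - v - y" "1 - v - y \<le> \<beta>" using y by (auto simp: \<beta>_def v_def)
  show ?thesis
  proof (cases "\<beta> = 0")
    case True
    then show ?thesis using 2 \<beta> by (simp add: v_def)
  next
    case False
    define t where "t = (1 - v - y) / \<beta>"
    have t: "0 \<le> t" "t \<le> 1" "t * \<beta> = 1 - v - y" using \<beta> False by (auto simp: t_def)
    have "t *\<^sub>R (v + x, \<beta>) + (1 - t) *\<^sub>R (v + x, 0) \<in> point_region k P n"
      using t by (intro convexD[OF convex_point_region] 1 2) auto
    also have "t *\<^sub>R (v + x, \<beta>) + (1 - t) *\<^sub>R (v + x, 0) = (v + x, 1 - v - y)"
      using t(3) by (simp add: algebra_simps)
    finally show ?thesis by (simp add: v_def)
  qed
qed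

end

section \<open>How the slope at the vertex changes\<close>

text \<open>
  Near the vertex the conditions of \<open>point_region_LS_plus\<close> become conditions on
  directions. Put \<open>a = 1/n + e\<close>, \<open>b = 1 - 1/n - m e\<close>, \<open>c = 1/n +
  g e\<close> and \<open>f = 1 - 2/n - h e\<close>. At \<open>e = 0\<close> all of
  \<open>A\<close>, \<open>B\<close>, \<open>C\<close> vanish and both conditioned points are
  the vertex for \<open>n - 1\<close> layers. The maps to the conditioned points are projective,
  so they carry lines to lines, and the linear inequalities are exact in \<open>e\<close>. Only
  the discriminant has terms of higher order; the strict inequality on \<open>D\<close> absorbs
  them for small \<open>e\<close>.

  Two parameters are chosen here. The value of \<open>h\<close> makes the point conditioned on a
  middle vertex leave its vertex with slope exactly \<open>-m'\<close>. With \<open>g = 1 - 4 /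
  (n - 2)\<close> the leading coefficient of \<open>A\<close> is 2 and the discriminant
  condition becomes \<open>(Q - m)^2 < D\<close>.
\<close>

lemma (in stable_relaxation) leaves_vertex_step:
  fixes n :: nat and m m' Q D :: real
  assumes n: "6 \<le> n" and prev: "leaves_vertex k P (n - 1) m'" and m': "1 \<le> m'"
    and m: "1 + 4 / (real n - 2) \<le> m" and Q: "Q = 4 * (real n - 1) / (real n - 2)"
    and D: "D = (real n - 1) * (m - m') + m' * (Q - m)" "2 * Q - m \<le> D" "(Q - m)\<^sup>2 < D"
  shows "leaves_vertex k (LS_plus (verts (layered_graph k C4)) P) n m"
proof -
  define N v q g h where "N = real n" and "v = 1 / N" and "q = 4 / (N - 2)" and "g = 1 - q"
    and "h = (m * (N - 2) + m' * ((N - 1) * g + m)) / (N - 1)"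
  have N: "6 \<le> N" using n by (simp add: N_def)
  have Nv: "N * v = 1" using N by (simp add: v_def)
  have v: "0 < v" "v \<le> 1 / 6" using N by (auto simp: v_def field_simps)
  have q: "0 < q" "q \<le> 1" "(N - 2) * q = 4" "Q = (N - 1) * q"
    using N by (auto simp: q_def Q N_def field_simps)
  have mq: "1 + q \<le> m" using m by (simp add: q_def N_def)
  have g: "0 \<le> g" "g \<le> 1" using q by (auto simp: g_def)
  have h: "(N - 1) * h = m * (N - 2) + m' * ((N - 1) * g + m)" using N by (simp add: h_def)
  have D': "D = (N - 1) * (m - m') + m' * (Q - m)" using D(1) by (simp add: N_def)
  have hD: "(N - 1) * h = (2 * N - 3) * m - D"
    using h D' q(4) unfolding g_def by algebra
  \<comment> \<open>Leaves a nonnegative weight for the set avoiding \<open>S\<close> when a middle vertex is not chosen.\<close>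
  have h_upper: "h \<le> 2 * m - 2 * q"
  proof -
    have "(N - 1) * h \<le> (N - 1) * (2 * m - 2 * q)"
      using hD D(2) q(4) by (simp add: algebra_simps)
    then show ?thesis using N by simp
  qed
  have h_lower: "m + g \<le> h"
  proof -
    have "0 \<le> (m' - 1) * ((N - 1) * g + m)" using m' g N mq q by simp
    then have "(N - 1) * (m + g) \<le> (N - 1) * h" unfolding h by (simp add: algebra_simps)
    then show ?thesis using N by simp
  qed
  \<comment> \<open>The point conditioned on an outer vertex not chosen leaves its vertex at least as steeply as \<open>-m'\<close>.\<close>
  have off_slope: "(N - 2) * (1 + q) + m' * ((N - 1) * g + 1 + q) \<le> (N - 1) * (m + g)"
  proof -
    have "0 \<le> (m' - 1) * (m - 1 - q)" using m' mq by simp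
    moreover have "(N - 1) * (m + g) - (N - 2) * (1 + q) - m' * ((N - 1) * g + 1 + q) =
        D - (2 * Q - m) + (m' - 1) * (m - 1 - q)"
      using D' q(4) unfolding g_def by algebra
    ultimately show ?thesis using D(2) by linarith
  qed
  have K: "real (n - 1) = N - 1" using n by (simp add: N_def of_nat_diff)
  have v1: "v / (1 - v) = 1 / (N - 1)" using N by (simp add: v_def field_simps)
  obtain \<epsilon>' where \<epsilon>': "0 < \<epsilon>'" "\<epsilon>' \<le> 1 / 2 - 1 / real (n - 1)"
    "(1 / real (n - 1) + \<epsilon>', 1 - 1 / real (n - 1) - m' * \<epsilon>') \<in> point_region k P (n - 1)"
    using prev unfolding leaves_vertex_def by blast
  define b c M where "b = (\<lambda>e. 1 - v - m * e)" and "c = (\<lambda>e. v + g * e)"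
    and "M = (\<lambda>e. 1 - v - (1 + q) * e)"
  \<comment> \<open>\<open>\<delta>\<close> also keeps the second coordinate \<open>1 - 1 / (N - 1) - m' * x\<close> nonnegative.\<close>
  define \<delta> where "\<delta> = min \<epsilon>' ((1 - 1 / (N - 1)) / m')"
  have \<delta>: "0 < \<delta>" using \<epsilon>'(1) N m' by (simp add: \<delta>_def field_simps)
  have "\<forall>\<^sub>F e in at_right 0. e < 1 / 2 - v"
    using v by (intro order_tendstoD(2)[of "\<lambda>e. e" 0]) (auto intro!: tendsto_eq_intros)
  moreover have "\<forall>\<^sub>F e in at_right 0. N * e < 1"
    by (rule order_tendstoD(2)[of "\<lambda>e. N * e" 0]) (auto intro!: tendsto_eq_intros)
  moreover have "\<forall>\<^sub>F e in at_right 0. 0 < b e"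
    unfolding b_def using v by (intro order_tendstoD(1)[of _ "1 - v"]) (auto intro!: tendsto_eq_intros)
  moreover have "\<forall>\<^sub>F e in at_right 0. 0 < b e - c e"
    unfolding b_def c_def using v
    by (intro order_tendstoD(1)[of _ "1 - v - v"]) (auto intro!: tendsto_eq_intros)
  moreover have "\<forall>\<^sub>F e in at_right 0. c e / b e - 1 / (N - 1) < \<delta>"
    unfolding b_def c_def using v \<delta>
    by (intro order_tendstoD(2)[of _ "v / (1 - v) - 1 / (N - 1)"]) (auto intro!: tendsto_eq_intros simp: v1)
  moreover have "\<forall>\<^sub>F e in at_right 0. c e / M e - 1 / (N - 1) < \<epsilon>'"
    unfolding M_def c_def using v \<epsilon>'(1)
    by (intro order_tendstoD(2)[of _ "v / (1 - v) - 1 / (N - 1)"]) (auto intro!: tendsto_eq_intros simp: v1)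
  moreover have "\<forall>\<^sub>F e in at_right 0. 0 < D - (Q - m)\<^sup>2 - e * (N * (D + m\<^sup>2 + 2 * m * (m - Q)))"
    using D(3) by (intro order_tendstoD(1)[of _ "D - (Q - m)\<^sup>2"]) (auto intro!: tendsto_eq_intros)
  moreover have "\<forall>\<^sub>F e in at_right (0 :: real). 0 < e"
    by (simp add: eventually_at_right_less)
  ultimately have "\<forall>\<^sub>F e in at_right 0. 0 < e \<and> e < 1 / 2 - v \<and> N * e < 1 \<and> 0 < b e \<and> 0 < b e - c e \<and>
      c e / b e - 1 / (N - 1) < \<delta> \<and> c e / M e - 1 / (N - 1) < \<epsilon>' \<and>
      0 < D - (Q - m)\<^sup>2 - e * (N * (D + m\<^sup>2 + 2 * m * (m - Q)))"
    by eventually_elim simp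
  then obtain e where e: "0 < e" "e < 1 / 2 - v" "N * e < 1" "0 < b e" "0 < b e - c e"
      "c e / b e - 1 / (N - 1) < \<delta>" "c e / M e - 1 / (N - 1) < \<epsilon>'"
      "0 < D - (Q - m)\<^sup>2 - e * (N * (D + m\<^sup>2 + 2 * m * (m - Q)))"
    using eventually_happens'[OF trivial_limit_at_right_real] by blast
  define f where "f = 1 - 2 * v - h * e"
  have ce: "0 \<le> c e" "c e \<le> v + e" using v g e(1) by (auto simp: c_def mult_le_cancel_right1)
  have bM: "b e \<le> M e" using mq e(1) by (simp add: b_def M_def)
  have Kc: "(N - 1) * c e = 1 - v + (N - 1) * g * e"
    using Nv unfolding c_def by algebra
  \<comment> \<open>Dividing a linear relation between \<open>b\<close>, \<open>c\<close> and \<open>f\<close> by the weight of the column gives a line through the vertex.\<close>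
  have project: "(N - 1) * t = (N - 2) - m' * ((N - 1) * r - 1) \<Longrightarrow>
        t = 1 - 1 / (N - 1) - m' * (r - 1 / (N - 1))"
      "(N - 1) * t + m' * ((N - 1) * r - 1) \<le> N - 2 \<Longrightarrow>
        m' * (r - 1 / (N - 1)) \<le> 1 - 1 / (N - 1) - t" for r t
  proof -
    define \<kappa> where "\<kappa> = 1 / (N - 1)"
    have "(N - 1) * \<kappa> = 1" using N by (simp add: \<kappa>_def)
    then have *: "(N - 1) * (1 - \<kappa> - t - m' * (r - \<kappa>)) = N - 2 - (N - 1) * t - m' * ((N - 1) * r - 1)"
      by algebra
    then show "t = 1 - 1 / (N - 1) - m' * (r - 1 / (N - 1))"
      if "(N - 1) * t = (N - 2) - m' * ((N - 1) * r - 1)"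
      using that N unfolding \<kappa>_def[symmetric] by simp
    show "m' * (r - 1 / (N - 1)) \<le> 1 - 1 / (N - 1) - t"
      if "(N - 1) * t + m' * ((N - 1) * r - 1) \<le> N - 2"
    proof -
      have "0 \<le> (N - 1) * (1 - \<kappa> - t - m' * (r - \<kappa>))" using * that by linarith
      then show ?thesis using N unfolding \<kappa>_def[symmetric] by (simp add: zero_le_mult_iff)
    qed
  qed
  have on: "(c e / b e, f / b e) \<in> point_region k P (n - 1)"
  proof -
    define x where "x = c e / b e - 1 / (N - 1)"
    have "0 \<le> (N - 1) * g * e" "0 \<le> m * e" using g N mq q e(1) by simp_all
    then have "b e \<le> (N - 1) * c e"
      using Kc by (simp add: b_def)
    then have x0: "0 \<le> x" using e(4) N by (simp add: x_def field_simps)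
    have "(N - 1) * f = (N - 2) * b e - m' * ((N - 1) * c e - b e)"
      using h Nv unfolding Kc f_def b_def by algebra
    then have "(N - 1) * (f / b e) = (N - 2) - m' * ((N - 1) * (c e / b e) - 1)"
      using e(4) by (simp add: field_simps)
    then have "f / b e = 1 - 1 / (N - 1) - m' * x"
      unfolding x_def by (rule project(1))
    moreover have "c e / b e = 1 / (N - 1) + x" by (simp add: x_def)
    moreover have "(1 / (N - 1) + x, 1 - 1 / (N - 1) - m' * x) \<in> point_region k P (n - 1)"
    proof -
      have "x \<le> \<epsilon>'" "x \<le> (1 - 1 / (N - 1)) / m'" using e(6) by (auto simp: x_def \<delta>_def)
      then have "m' * x \<le> 1 - 1 / (N - 1)" using m' by (simp add: field_simps)
      then show ?thesis
        using point_region_below[OF _ \<epsilon>', of x "m' * x"] n x0 \<open>x \<le> \<epsilon>'\<close> unfolding K by simp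
    qed
    ultimately show ?thesis by simp
  qed
  have off: "(c e / M e, (b e - c e) / M e) \<in> point_region k P (n - 1)"
  proof -
    have M: "0 < M e" using bM e(4) by simp
    define x y where "x = c e / M e - 1 / (N - 1)" and "y = 1 - 1 / (N - 1) - (b e - c e) / M e"
    have "0 \<le> (N - 1) * g * e" "0 \<le> (1 + q) * e" using g N q e(1) by simp_all
    then have "M e \<le> (N - 1) * c e"
      using Kc by (simp add: M_def)
    then have x0: "0 \<le> x" using M N by (simp add: x_def field_simps)
    have "(N - 1) * (b e - c e) - (N - 2) * M e + m' * ((N - 1) * c e - M e) =
        e * ((N - 2) * (1 + q) + m' * ((N - 1) * g + 1 + q) - (N - 1) * (m + g))"
      using Nv unfolding Kc b_def M_def c_def by algebra
    also have "\<dots> \<le> 0" using off_slope e(1) by (simp add: mult_le_0_iff)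
    finally have le: "(N - 1) * (b e - c e) + m' * ((N - 1) * c e - M e) \<le> (N - 2) * M e" by simp
    have "(N - 1) * ((b e - c e) / M e) + m' * ((N - 1) * (c e / M e) - 1) \<le> N - 2" (is "?L \<le> _")
    proof (rule mult_right_le_imp_le[OF _ M])
      have "?L * M e = (N - 1) * (b e - c e) + m' * ((N - 1) * c e - M e)"
        using M by (simp add: field_simps)
      then show "?L * M e \<le> (N - 2) * M e" using le by simp
    qed
    then have "m' * x \<le> y"
      unfolding x_def y_def by (rule project(2))
    moreover have "y \<le> 1 - 1 / (N - 1)" using e(5) M by (simp add: y_def)
    ultimately have "(1 / (N - 1) + x, 1 - 1 / (N - 1) - y) \<in> point_region k P (n - 1)"
      using point_region_below[OF _ \<epsilon>', of x y] n x0 e(7) unfolding K x_def[symmetric] by simp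
    then show ?thesis by (simp add: x_def y_def)
  qed
  define A B C where "A = N * (v + e) * (1 - 2 * (v + e)) - (N - 2) * c e"
    and "B = (N - 1) * c e - N * (v + e) * b e" and "C = b e + (N - 1) * f - N * (b e)\<^sup>2"
  have A: "A = 2 * e * (1 - N * e)"
    using Nv q(3) unfolding A_def c_def g_def by algebra
  have B: "B = e * (m - Q) + N * m * e\<^sup>2"
    using Nv q(4) unfolding B_def Kc b_def g_def by algebra
  have C: "C = e * D - N * m\<^sup>2 * e\<^sup>2"
    using Nv hD unfolding C_def b_def f_def by algebra
  have "0 \<le> 2 * e\<^sup>2 * (D - (Q - m)\<^sup>2 - e * (N * (D + m\<^sup>2 + 2 * m * (m - Q))))"
    using e(8) by simp
  also have "\<dots> = A * C - 2 * B\<^sup>2" unfolding A B C by algebra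
  finally have det: "2 * B\<^sup>2 \<le> A * C" by simp
  have "(v + e, b e) \<in> point_region k (LS_plus (verts (layered_graph k C4)) P) n"
  proof (rule point_region_LS_plus[where c = "c e" and f = f and M = "M e" and A = A and B = B and C = C])
    show "1 \<le> n" using n by simp
    show "M e = 1 - 2 * (v + e) + c e" by (simp add: M_def c_def g_def algebra_simps)
    have "(h - 2 * m + 2 * q) * e \<le> 0" using h_upper e(1) by (simp add: mult_le_0_iff)
    then show "2 * (v + e) + 2 * b e - 2 * c e - f \<le> 1"
      by (simp add: b_def c_def f_def g_def algebra_simps)
    have "(m + g - h) * e \<le> 0" using h_lower e(1) by (simp add: mult_le_0_iff)
    then show "f \<le> b e - c e" by (simp add: f_def b_def c_def algebra_simps)
    show "0 < A" using A e(1,3) by simp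
  qed (use ce e bM det on off in \<open>simp_all add: A_def B_def C_def N_def\<close>)
  then show ?thesis
    using e(1,2) unfolding leaves_vertex_def b_def v_def N_def by (intro exI[of _ e]) simp
qed

text \<open>
  A solution of the recursion for the slopes along \<open>n = s + 3 + p\<close>. At the start,
  where \<open>m\<close> and \<open>m'\<close> are near 1 and \<open>Q\<close> near 4, the
  condition \<open>(Q - m)^2 < D\<close> asks for \<open>n (m - m') > 6\<close>, and the
  coefficient 7 leaves room for small \<open>n\<close>; the required speed then decreases, which
  the growing denominator \<open>s + 3 p\<close> allows for. The last conclusion compares
  \<open>m\<close> with the slope of the stable set polytope. The inequalities hold because,
  after clearing denominators and substituting \<open>p = 1 + 2 w\<close> and \<open>s = 2 + u +
  9 w\<close> with \<open>u, w \<ge> 0\<close>, every coefficient is positive.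
\<close>

lemma schedule_inequalities:
  fixes s p m m' Q D :: real
  assumes p: "1 \<le> p" and s: "9 * p \<le> 2 * s + 5"
    and m: "m = 1 + 7 * p / (s + 3 * p)" and m': "m' = 1 + 7 * (p - 1) / (s + 3 * (p - 1))"
    and Q: "Q = 4 * (s + p + 2) / (s + p + 1)"
    and D: "D = (s + p + 2) * (m - m') + m' * (Q - m)"
  shows "1 + 4 / (s + p + 1) \<le> m" "2 * Q - m \<le> D" "(Q - m)\<^sup>2 < D" "1 \<le> m'"
    "(s + p + 1) * m < 2 * (s + p + 2)"
proof -
  define w u where "w = (p - 1) / 2" and "u = s - 2 - 9 * w"
  have w: "0 \<le> w" and u: "0 \<le> u" using p s by (auto simp: w_def u_def)
  have p': "p = 1 + 2 * w" and s': "s = 2 + u + 9 * w" by (simp_all add: w_def u_def field_simps)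
  define D0 D1 E where "D0 = s + 3 * (p - 1)" and "D1 = s + 3 * p" and "E = s + p + 1"
  have pos: "0 < D0" "0 < D1" "0 < E" using w u by (auto simp: D0_def D1_def E_def p' s')
  have mD: "m * D1 = s + 10 * p" using pos(2) by (simp add: m D1_def field_simps)
  have mD': "m' * D0 = s + 10 * (p - 1)" using pos(1) by (simp add: m' D0_def field_simps)
  have QE: "Q * E = 4 * (E + 1)" using pos(3) by (simp add: Q E_def field_simps)
  have cancel: "0 \<le> x * y \<Longrightarrow> 0 < y \<Longrightarrow> 0 \<le> x" "0 < x * y \<Longrightarrow> 0 < y \<Longrightarrow> 0 < x" for x y :: real
    by (simp_all add: zero_le_mult_iff zero_less_mult_iff)
  show "1 \<le> m'" using p pos(1) by (simp add: m' D0_def)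
  show "1 + 4 / (s + p + 1) \<le> m"
  proof -
    have "(m - 1) * E * D1 - 4 * D1 = X" if "X = 7 * p * E - 4 * D1" for X
      using mD that unfolding D1_def by algebra
    then have "(m - 1) * E * D1 - 4 * D1 = 7 * p * E - 4 * D1" by simp
    also have "\<dots> = 8 + 3 * u + 73 * w + 14 * (w * u) + 154 * w\<^sup>2"
      unfolding E_def D1_def p' s' by algebra
    also have "\<dots> \<ge> 0" using w u by simp
    finally have "4 * D1 \<le> (m - 1) * E * D1" by simp
    then have "4 \<le> (m - 1) * E" using pos(2) by simp
    then show ?thesis using pos(3) unfolding E_def[symmetric] by (simp add: field_simps)
  qed
  show "(s + p + 1) * m < 2 * (s + p + 2)"
  proof -
    have "(2 * (s + p + 2) - (s + p + 1) * m) * D1 = 2 * (s + p + 2) * D1 - (s + p + 1) * (s + 10 * p)"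
      using mD by algebra
    also have "\<dots> = 2 + 4 * u + 12 * w + u\<^sup>2 + 12 * (w * u) + 11 * w\<^sup>2"
      unfolding D1_def p' s' by algebra
    also have "\<dots> > 0" using w u by (intro add_pos_nonneg) auto
    finally show ?thesis using pos(2) by (simp add: zero_less_mult_iff)
  qed
  have DD: "D * E * D1 * D0 = X" if "X = (E + 1) * 7 * s * E + (s + 10 * (p - 1)) * (4 * (E + 1) * D1 - (s + 10 * p) * E)" for X
  proof -
    have "D * E * D1 * D0 = (E + 1) * E * (m * D1 * D0 - m' * D0 * D1) + m' * D0 * (Q * E * D1 - m * D1 * E)"
      unfolding D E_def by algebra
    also have "\<dots> = X" unfolding mD mD' QE that unfolding D1_def D0_def by algebra
    finally show ?thesis .
  qed
  show "2 * Q - m \<le> D"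
  proof -
    have "(D - (2 * Q - m)) * (E * D1 * D0) = D * E * D1 * D0 - (2 * (Q * E) * D1 - m * D1 * E) * D0"
      by algebra
    also have "\<dots> = (E + 1) * 7 * s * E + (s + 10 * (p - 1)) * (4 * (E + 1) * D1 - (s + 10 * p) * E)
        - (8 * (E + 1) * D1 - (s + 10 * p) * E) * D0"
      unfolding DD[OF refl] mD QE by algebra
    also have "\<dots> = 80 + 86 * u + 29 * u ^ 2 + 3 * u ^ 3 + 834 * w + 576 * (w * u) + 95 * (w * u ^ 2) + 2619
        * w ^ 2 + 909 * (w ^ 2 * u) + 2497 * w ^ 3"
      unfolding E_def D1_def D0_def p' s' by algebra
    also have "\<dots> \<ge> 0" using w u by simp
    finally have "0 \<le> D - (2 * Q - m)" by (rule cancel(1)) (use pos in simp)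
    then show ?thesis by simp
  qed
  show "(Q - m)\<^sup>2 < D"
  proof -
    have "(D - (Q - m)\<^sup>2) * (E\<^sup>2 * D1\<^sup>2 * D0) = D * E * D1 * D0 * (E * D1) - (Q * E * D1 - m * D1 * E)\<^sup>2 * D0"
      by algebra
    also have "\<dots> = ((E + 1) * 7 * s * E + (s + 10 * (p - 1)) * (4 * (E + 1) * D1 - (s + 10 * p) * E)) * (E * D1)
        - (4 * (E + 1) * D1 - (s + 10 * p) * E)\<^sup>2 * D0"
      unfolding DD[OF refl] mD QE by (rule refl)
    also have "\<dots> = 2272 + 3080 * u + 1546 * u ^ 2 + 353 * u ^ 3 + 35 * u ^ 4 + 1 * u ^ 5 + 40984 * w +
        42484 * (w * u) + 15415 * (w * u ^ 2) + 2276 * (w * u ^ 3) + 109 * (w * u ^ 4) + 290434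
        * w ^ 2 + 218511 * (w ^ 2 * u) + 51582 * (w ^ 2 * u ^ 2) + 3746 * (w ^ 2 * u ^ 3) +
        1010297 * w ^ 3 + 495084 * (w ^ 3 * u) + 57634 * (w ^ 3 * u ^ 2) + 1721423 * w ^ 4 +
        415261 * (w ^ 4 * u) + 1145265 * w ^ 5"
      unfolding E_def D1_def D0_def p' s' by algebra
    also have "\<dots> > 0" using w u by (intro add_pos_nonneg) auto
    finally have "0 < D - (Q - m)\<^sup>2" by (rule cancel(2)) (use pos in simp)
    then show ?thesis by simp
  qed
qed

section \<open>The rank bound\<close>

text \<open>
  The segment \<open>a + b = 1\<close> can be followed from the vertex to \<open>(1/2,
  1/2)\<close>, where the edges between $i_0$ and $j_2$ become tight as well.
\<close>

lemma leaves_vertex_FRAC: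
  assumes n: "3 \<le> n"
  shows "leaves_vertex k (FRAC (layered_graph k C4)) n 1"
proof -
  have "(1 / 2, 1 / 2) \<in> point_region k (FRAC (layered_graph k C4)) n"
  proof (rule point_regionI)
    fix S T :: "nat set"
    assume ST: "S \<subseteq> {1..k}" "T \<subseteq> {1..k}" "S \<inter> T = {}"
    let ?x = "layer_point S T (1 / 2) (1 / 2)"
    have val: "?x (i, p) \<le> 1 / 2 \<or> ?x (i, p) = 1 \<and> i \<in> T \<and> i \<notin> S \<and> p = 1" for i p
      by (simp add: layer_point_def)
    have nbr: "?x (j, q) = 0"
      if e: "{(i, p), (j, q)} \<in> edges (layered_graph k C4)" and i: "i \<in> T" "i \<notin> S" "p = 1" for i p j q
    proof (cases "i = j")
      case True
      then have "q \<noteq> 1" using e i unfolding edges_layered_C4 by auto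
      then show ?thesis using True i by (simp add: layer_point_def)
    next
      case False
      then have "q \<noteq> 1" "odd q" using e i unfolding edges_layered_C4 by auto
      then have "q \<noteq> 0" "q \<noteq> 1" "q \<noteq> 2" by (metis even_zero, simp, metis even_numeral)
      then show ?thesis by (simp add: layer_point_def)
    qed
    have edge: "?x u + ?x v \<le> 1" if e: "{u, v} \<in> edges (layered_graph k C4)" for u v
    proof -
      obtain i p j q where uv: "u = (i, p)" "v = (j, q)" by (cases u; cases v)
      have e': "{(j, q), (i, p)} \<in> edges (layered_graph k C4)"
        using e unfolding uv by (simp add: insert_commute)
      consider "?x (i, p) \<le> 1 / 2" "?x (j, q) \<le> 1 / 2" | "?x (i, p) = 1" "?x (j, q) = 0"
        | "?x (j, q) = 1" "?x (i, p) = 0"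
        using val[of i p] val[of j q] nbr[OF e[unfolded uv]] nbr[OF e'] by blast
      then show ?thesis unfolding uv by cases simp_all
    qed
    have "0 \<le> ?x v \<and> ?x v \<le> 1" for v
      by (simp add: layer_point_def split: prod.split)
    moreover have "?x \<in> coord_space (verts (layered_graph k C4))"
      using ST(1,2) by (force simp: coord_space_def verts_layered_C4 layer_point_def)
    ultimately show "?x \<in> FRAC (layered_graph k C4)"
      using edge unfolding FRAC_def by blast
  qed
  then show ?thesis
    using n unfolding leaves_vertex_def by (intro exI[of _ "1 / 2 - 1 / real n"]) (simp add: field_simps)
qed

lemma leaves_vertex_iterate:
  assumes "p \<le> P" "9 * P \<le> 2 * s + 5"
  shows "leaves_vertex k ((LS_plus (verts (layered_graph k C4)) ^^ p) (FRAC (layered_graph k C4)))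
    (s + 3 + p) (1 + 7 * real p / (real s + 3 * real p))"
  using assms(1)
proof (induction p)
  case 0
  then show ?case using leaves_vertex_FRAC[of "s + 3" k] by simp
next
  case (Suc p)
  interpret stable_relaxation k "(LS_plus (verts (layered_graph k C4)) ^^ p) (FRAC (layered_graph k C4))"
    by (rule stable_relaxation_iterate)
  let ?P = "real (Suc p)" and ?s = "real s"
  let ?n = "s + 3 + Suc p"
  have P: "1 \<le> ?P" "9 * ?P \<le> 2 * ?s + 5" using assms(2) Suc.prems by simp_all
  have n: "6 \<le> ?n" using assms(2) Suc.prems by simp
  have real_n: "real ?n - 2 = ?s + ?P + 1" "real ?n - 1 = ?s + ?P + 2" by simp_all
  note ineq = schedule_inequalities[OF P refl refl refl refl]
  have prev: "leaves_vertex k ((LS_plus (verts (layered_graph k C4)) ^^ p) (FRAC (layered_graph k C4)))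
      (?n - 1) (1 + 7 * (?P - 1) / (?s + 3 * (?P - 1)))"
    using Suc by (simp add: ac_simps)
  show ?case
    unfolding funpow.simps o_apply
    by (rule leaves_vertex_step[OF n prev ineq(4) _ refl refl]) (unfold real_n, fact ineq(1), fact ineq(2), fact ineq(3))
qed

text \<open>
  Let a stable set contain both $j_0$ and $j_2$. Then no other layer uses position 0 or 2, and
  each contributes at most \<open>k - 2\<close>. If there is no such layer, every layer
  contributes at most \<open>k - 1\<close>. Both cases attain \<open>k (k - 1)\<close>.
\<close>

lemma layered_C4_valid_inequality:
  assumes k: "2 \<le> k" and x: "x \<in> STAB (layered_graph k C4)"
  shows "(\<Sum>i=1..k. (real k - 1) * (x (i, 0) + x (i, 2)) + (real k - 2) * x (i, 1)) \<le> real k * (real k - 1)"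
proof -
  let ?L = "\<lambda>x :: nat \<times> nat \<Rightarrow> real. \<Sum>i=1..k. (real k - 1) * (x (i, 0) + x (i, 2)) + (real k - 2) * x (i, 1)"
  let ?H = "{x. ?L x \<le> real k * (real k - 1)}"
  have int: "?L x \<le> real k * (real k - 1)"
    if xF: "x \<in> FRAC (layered_graph k C4)" and x01: "\<forall>v \<in> verts (layered_graph k C4). x v \<in> {0, 1}"
    for x :: "nat \<times> nat \<Rightarrow> real"
  proof -
    have edge: "x (i, p) + x (j, q) \<le> 1" if "{(i, p), (j, q)} \<in> edges (layered_graph k C4)" for i p j q
      using xF that unfolding FRAC_def by blast
    have x01': "x (i, p) = 0 \<or> x (i, p) = 1" if "i \<in> {1..k}" "p \<in> {0, 1, 2}" for i p
      using x01 that unfolding verts_layered_C4 by auto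
    have e01: "x (i, 0) + x (i, 1) \<le> 1" "x (i, 2) + x (i, 1) \<le> 1" if "i \<in> {1..k}" for i
      using that by (auto intro!: edge simp: edges_layered_C4)
    have e02: "x (i, 0) + x (j, 2) \<le> 1" if "i \<in> {1..k}" "j \<in> {1..k}" "i \<noteq> j" for i j
      using that by (auto intro!: edge simp: edges_layered_C4)
    show ?thesis
    proof (cases "\<exists>i \<in> {1..k}. x (i, 0) = 1 \<and> x (i, 2) = 1")
      case True
      then obtain j where j: "j \<in> {1..k}" "x (j, 0) = 1" "x (j, 2) = 1" by blast
      have "x (j, 1) = 0" using e01(1)[OF j(1)] x01'[OF j(1), of 1] j(2) by auto
      have rest: "(real k - 1) * (x (i, 0) + x (i, 2)) + (real k - 2) * x (i, 1) \<le> real k - 2"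
        if i: "i \<in> {1..k} - {j}" for i
      proof -
        have "x (i, 0) = 0" "x (i, 2) = 0"
          using e02[of i j] e02[of j i] x01'[of i 0] x01'[of i 2] i j by auto
        then show ?thesis using x01'[of i 1] i k by auto
      qed
      have "?L x = 2 * (real k - 1) + (\<Sum>i\<in>{1..k} - {j}. (real k - 1) * (x (i, 0) + x (i, 2)) + (real k - 2) * x (i, 1))"
        using j \<open>x (j, 1) = 0\<close> by (subst sum.remove[of _ j]) auto
      also have "\<dots> \<le> 2 * (real k - 1) + (\<Sum>i\<in>{1..k} - {j}. real k - 2)"
        by (intro add_mono order_refl sum_mono rest)
      also have "\<dots> = real k * (real k - 1)"
        using j k by (simp add: of_nat_diff algebra_simps)
      finally show ?thesis .
    next
      case False
      have "(real k - 1) * (x (i, 0) + x (i, 2)) + (real k - 2) * x (i, 1) \<le> real k - 1"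
        if i: "i \<in> {1..k}" for i
        using x01'[OF i, of 0] x01'[OF i, of 1] x01'[OF i, of 2] e01[OF i] False i k by auto
      then have "?L x \<le> (\<Sum>i=1..k. real k - 1)" by (intro sum_mono)
      then show ?thesis by simp
    qed
  qed
  have "convex ?H"
  proof (rule convexI)
    fix x y :: "nat \<times> nat \<Rightarrow> real" and s t :: real
    assume xy: "x \<in> ?H" "y \<in> ?H" and st: "0 \<le> s" "0 \<le> t" "s + t = 1"
    have "?L (s *\<^sub>R x + t *\<^sub>R y) = s * ?L x + t * ?L y"
      unfolding sum_distrib_left sum.distrib[symmetric]
      by (intro sum.cong) (simp_all add: algebra_simps)
    also have "\<dots> \<le> real k * (real k - 1)"
      using xy st by (intro convex_bound_le) auto
    finally show "s *\<^sub>R x + t *\<^sub>R y \<in> ?H" by simp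
  qed
  then have "STAB (layered_graph k C4) \<subseteq> ?H"
    unfolding STAB_def using int by (intro hull_minimal) auto
  then show ?thesis using x by auto
qed

text \<open>
  The vertex satisfies the valid inequality with equality, and moving away from it with slope
  \<open>-m\<close> violates the inequality exactly if \<open>(k - 2) m < 2 (k - 1)\<close>.
\<close>

lemma not_STAB_if_leaves_vertex:
  assumes k: "3 \<le> k" and lv: "leaves_vertex k P k m" and m: "(real k - 2) * m < 2 * (real k - 1)"
  shows "P \<noteq> STAB (layered_graph k C4)"
proof
  assume P: "P = STAB (layered_graph k C4)"
  obtain e where e: "0 < e" and r: "(1 / real k + e, 1 - 1 / real k - m * e) \<in> point_region k P k"
    using lv unfolding leaves_vertex_def by blast
  let ?x = "layer_point {1..k} {} (1 / real k + e) (1 - 1 / real k - m * e)"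
  have "?x \<in> P" by (rule point_regionD[OF r]) auto
  then have "(\<Sum>i=1..k. (real k - 1) * (?x (i, 0) + ?x (i, 2)) + (real k - 2) * ?x (i, 1)) \<le> real k * (real k - 1)"
    using k unfolding P by (intro layered_C4_valid_inequality) auto
  then have "real k * ((real k - 1) * (2 * (1 / real k + e)) + (real k - 2) * (1 - 1 / real k - m * e))
      \<le> real k * (real k - 1)"
    by (simp add: layer_point_def)
  then have "(real k - 1) * (2 * (1 / real k + e)) + (real k - 2) * (1 - 1 / real k - m * e) \<le> real k - 1"
    using k by simp
  moreover have "(real k - 1) * (2 * (1 / real k + e)) + (real k - 2) * (1 - 1 / real k - m * e) =
      real k - 1 + e * (2 * (real k - 1) - (real k - 2) * m)"
    using k by (simp add: field_simps)
  ultimately have "e * (2 * (real k - 1) - (real k - 2) * m) \<le> 0" by simp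
  then show False using e m by (simp add: mult_le_0_iff)
qed

theorem theorem34:
  fixes k :: nat and G :: "(nat \<times> nat) ugraph"
  assumes "k \<ge> 3" and "G = layered_graph k C4"
  shows "real (LS_plus_rank G) \<ge> 1 / 22 * real (card (verts G))"
proof (rule ccontr)
  define r where "r = LS_plus_rank G"
  have card: "card (verts G) = 4 * k" by (simp add: assms(2) verts_layered_C4 card_cartesian_product)
  assume "\<not> ?thesis"
  then have r: "11 * r < 2 * k" by (simp add: card r_def)
  \<comment> \<open>\<open>s\<close> is chosen such that \<open>r\<close> steps from \<open>s + 3\<close> layers, each adding one layer, end with all \<open>k\<close> layers.\<close>
  define s where "s = k - 3 - r"
  have s: "k = s + 3 + r" "9 * r \<le> 2 * s + 5" using r assms(1) by (auto simp: s_def)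
  define m where "m = 1 + 7 * real r / (real s + 3 * real r)"
  have "leaves_vertex k ((LS_plus (verts G) ^^ r) (FRAC G)) k m"
    using leaves_vertex_iterate[OF order_refl s(2), of k] unfolding assms(2) m_def s(1)[symmetric] .
  moreover have "(LS_plus (verts G) ^^ r) (FRAC G) = STAB G"
    unfolding r_def by (rule LS_plus_rank_iterate) (simp add: assms(2) verts_layered_C4)
  moreover have "(real k - 2) * m < 2 * (real k - 1)"
  proof (cases "r = 0")
    case True
    then show ?thesis using assms(1) by (simp add: m_def)
  next
    case False
    have "9 * real r \<le> 2 * real s + 5" using s(2) by linarith
    from schedule_inequalities(5)[OF _ this m_def refl refl refl] False
    have "(real s + real r + 1) * m < 2 * (real s + real r + 2)" by simp
    then show ?thesis by (simp add: s(1) algebra_simps)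
  qed
  ultimately show False
    using not_STAB_if_leaves_vertex[OF assms(1)] unfolding assms(2) by blast
qed

end
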